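(* For all integers $n\ge2$, $m\ge0$ and $j\in\{1,2,3,4\}$, $$\begin{bmatrix} F_j(n+m,a_{n-1,1}) \\ F_j(n+m,b_{n-1,1}) \\ F_j(n+m,c_{n-1,1}) \end{bmatrix}=\begin{bmatrix} F_j(n+m,\tilde a_{n-1,1}) \\ F_j(n+m,\tilde b_{n-1,1}) \\ F_j(n+m,\tilde c_{n-1,1}) \end{bmatrix}=B_j(n-1,n-2)\,R\,L^m\,e_1,$$ where $e_1=(1,0,0,0,0)^T$, $$L=\begin{bmatrix}\frac23&\frac35&\frac35&\frac35&\frac6{25} \\ \frac16&\frac3{10}&\frac1{10}&0&\frac7{50} \\ \frac16&\frac1{10}&\frac3{10}&\frac1{10}&\frac7{50} \\ 0&0&0&\frac3{10}&\frac6{25} \\ 0&0&0&0&\frac6{25}\end{bmatrix},\qquad R=\begin{bmatrix}\frac23&\frac35&\frac1{10}&\frac35&\frac6{25} \\ \frac16&\frac3{10}&\frac1{10}&\frac1{10}&\frac7{50} \\ 0&0&\frac25&0&\frac6{25} \\ \frac16&\frac1{10}&\frac1{10}&\frac3{10}&\frac7{50} \\ 0&0&\frac3{10}&0&\frac6{25}\end{bmatrix}.$$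
   Context: The two-dimensional Sierpinski gasket graph $SG(n)$, $n\ge 0$, is drawn in the plane with three outmost vertices: leftmost $o$, rightmost $a_n$, topmost $b_n$. $SG(0)$ is an equilateral triangle (3 vertices, 3 edges). $SG(n+1)$ consists of three copies of $SG(n)$ (lower-left, lower-right, top), where the rightmost vertex of the lower-left copy is identified with the leftmost vertex of the lower-right copy, the topmost vertex of the lower-left copy with the leftmost vertex of the top copy, and the topmost vertex of the lower-right copy with the rightmost vertex of the top copy. For $k\le N$, $SG(k)$ is regarded as the sub-copy of $SG(N)$ containing the leftmost vertex $o$ (iterating the lower-left copy), so vertices of $SG(k)$ (in particular $a_k,b_k$) are vertices of $SG(N)$; $c_k$ is the vertex of $SG(k+1)$ shared by its lower-right and top copies of $SG(k)$. Vertices $x_{n-1,1}$ ($n\ge2$): the lower-right copy of $SG(n-1)$ in $SG(n)$ has outmost vertices $a_{n-1}$ (left), $a_n$ (right), $c_{n-1}$ (top); $a_{n-1,1}$, $b_{n-1,1}$, $c_{n-1,1}$ are the midpoints of its bottom side, left side and right side, respectively. $\tilde x_{n-1,1}$ is the reflection of $x_{n-1,1}$ in the line through $o$ and $c_{n-1}$ (the symmetry axis of $SG(n)$ through $o$). Counts: $f(n)$ is the number of spanning trees of $SG(n)$; $g(n)$ is the number of spanning subgraphs of $SG(n)$ consisting of exactly two trees (an isolated vertex counts as a tree) with $b_n$ in one tree and $o,a_n$ both in the other; $h(n)$ is the number of spanning subgraphs consisting of exactly three trees with $o,a_n,b_n$ in three different trees. $f_j(n,x),g_j(n,x),h_j(n,x)$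 are the numbers of those subgraphs, respectively, in which exactly $j$ edges of the subgraph are incident to the vertex $x$; $F_j=f_j/f$, $G_j=g_j/g$, $H_j=h_j/h$. Matrix: for $N\ge1$, $B_j(N,N-1)$ is the $3\times5$ matrix whose rows are indexed by $x=a_{N-1},b_{N-1},c_{N-1}$ in this order, the row of $x$ being $$\bigl(F_j(N,x),\,G_j(N,x),\,G_j(N,\tilde x),\,G_j(N,\hat x),\,H_j(N,x)\bigr),$$ where $\tilde{\ }$ is the reflection of $SG(N)$ fixing $o$ and swapping $a_N,b_N$ (so $\tilde a_{N-1}=b_{N-1}$, $\tilde b_{N-1}=a_{N-1}$, $\tilde c_{N-1}=c_{N-1}$) and $\hat{\ }$ is the reflection of $SG(N)$ fixing $a_N$ and swapping $o,b_N$, i.e. in the line through $a_N$ and $b_{N-1}$ (so $\hat a_{N-1}=c_{N-1}$, $\hat b_{N-1}=b_{N-1}$, $\hat c_{N-1}=a_{N-1}$). *)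

theory Defs
  imports Complex_Main "Jordan_Normal_Form.Matrix"
begin

text \<open>A finite simple graph is given by a vertex set and a set of two-element edges.\<close>

definition reachable :: "'a set set \<Rightarrow> 'a \<Rightarrow> 'a \<Rightarrow> bool" where
  "reachable E u v \<longleftrightarrow> (u, v) \<in> {(x, y). {x, y} \<in> E}\<^sup>*"

definition components :: "'a set \<Rightarrow> 'a set set \<Rightarrow> 'a set set" where
  "components V E = (\<lambda>u. {v \<in> V. reachable E u v}) ` V"

definition induced_edges :: "'a set set \<Rightarrow> 'a set \<Rightarrow> 'a set set" where
  "induced_edges E C = {e \<in> E. e \<subseteq> C}"

definition is_cycle :: "'a set set \<Rightarrow> 'a list \<Rightarrow> bool" where
  "is_cycle E p \<longleftrightarrow> 3 \<le> length p \<and> distinct p \<and>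
     (\<forall>i < length p. {p ! i, p ! (Suc i mod length p)} \<in> E)"

definition is_tree :: "'a set \<Rightarrow> 'a set set \<Rightarrow> bool" where
  "is_tree V E \<longleftrightarrow> V \<noteq> {} \<and> (\<forall>u \<in> V. \<forall>v \<in> V. reachable E u v) \<and> (\<nexists>p. is_cycle E p)"

text \<open>A spanning subgraph contains all vertices, so it is identified with its edge set.\<close>

definition spanning_trees :: "'a set \<Rightarrow> 'a set set \<Rightarrow> 'a set set set" where
  "spanning_trees V E = {T. T \<subseteq> E \<and> is_tree V T}"

definition two_tree_subgraphs ::
  "'a set \<Rightarrow> 'a set set \<Rightarrow> 'a \<Rightarrow> 'a \<Rightarrow> 'a \<Rightarrow> 'a set set set" where
  "two_tree_subgraphs V E u v w = {T. T \<subseteq> E \<and>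
     (\<exists>C D. C \<noteq> D \<and> components V T = {C, D} \<and>
        is_tree C (induced_edges T C) \<and> is_tree D (induced_edges T D) \<and>
        u \<in> C \<and> v \<in> C \<and> w \<in> D)}"

definition three_tree_subgraphs ::
  "'a set \<Rightarrow> 'a set set \<Rightarrow> 'a \<Rightarrow> 'a \<Rightarrow> 'a \<Rightarrow> 'a set set set" where
  "three_tree_subgraphs V E u v w = {T. T \<subseteq> E \<and>
     (\<exists>A C D. A \<noteq> C \<and> A \<noteq> D \<and> C \<noteq> D \<and> components V T = {A, C, D} \<and>
        is_tree A (induced_edges T A) \<and> is_tree C (induced_edges T C) \<and>
        is_tree D (induced_edges T D) \<and>
        u \<in> A \<and> v \<in> C \<and> w \<in> D)}"

definition edges_at :: "'a set set \<Rightarrow> 'a \<Rightarrow> nat" where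
  "edges_at T x = card {e \<in> T. x \<in> e}"

text \<open>The Sierpinski gasket graph in oblique lattice coordinates: the pair \<open>(x, y)\<close> stands
  for the point \<open>x (1, 0) + y (1/2, sqrt 3 / 2)\<close> of the plane, scaled so that all edges have
  length 1. The outmost vertices are \<open>o = (0, 0)\<close>, \<open>a\<^sub>n = (2^n, 0)\<close> and
  \<open>b\<^sub>n = (0, 2^n)\<close>. The copies forming stage \<open>n + 1\<close> are translates of stage \<open>n\<close>; their
  common points are exactly the vertices to be identified (\<open>sg_copies_meet\<close> below).\<close>

type_synonym vertex = "nat \<times> nat"

definition translate :: "vertex \<Rightarrow> vertex \<Rightarrow> vertex" where
  "translate d p = (fst d + fst p, snd d + snd p)"

definition sg_o :: vertex where "sg_o = (0, 0)"
definition sg_a :: "nat \<Rightarrow> vertex" where "sg_a n = (2 ^ n, 0)"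
definition sg_b :: "nat \<Rightarrow> vertex" where "sg_b n = (0, 2 ^ n)"
definition sg_c :: "nat \<Rightarrow> vertex" where "sg_c n = (2 ^ n, 2 ^ n)"

primrec sg_verts :: "nat \<Rightarrow> vertex set" where
  "sg_verts 0 = {sg_o, sg_a 0, sg_b 0}"
| "sg_verts (Suc n) = sg_verts n \<union> translate (sg_a n) ` sg_verts n
     \<union> translate (sg_b n) ` sg_verts n"

primrec sg_edges :: "nat \<Rightarrow> vertex set set" where
  "sg_edges 0 = {{sg_o, sg_a 0}, {sg_o, sg_b 0}, {sg_a 0, sg_b 0}}"
| "sg_edges (Suc n) = sg_edges n \<union> (`) (translate (sg_a n)) ` sg_edges n
     \<union> (`) (translate (sg_b n)) ` sg_edges n"

lemma sg_outmost: "sg_o \<in> sg_verts n \<and> sg_a n \<in> sg_verts n \<and> sg_b n \<in> sg_verts n"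
proof (induction n)
  case 0
  show ?case by simp
next
  case (Suc n)
  have "sg_a (Suc n) = translate (sg_a n) (sg_a n)" "sg_b (Suc n) = translate (sg_b n) (sg_b n)"
    by (simp_all add: translate_def sg_a_def sg_b_def)
  with Suc show ?case by simp
qed

lemma sg_verts_bound: "p \<in> sg_verts n \<Longrightarrow> fst p + snd p \<le> 2 ^ n"
proof (induction n arbitrary: p)
  case 0
  then show ?case by (auto simp: sg_o_def sg_a_def sg_b_def)
next
  case (Suc n)
  then consider "p \<in> sg_verts n"
    | q where "q \<in> sg_verts n" "p = translate (sg_a n) q"
    | q where "q \<in> sg_verts n" "p = translate (sg_b n) q"
    by auto
  then show ?case
  proof cases
    case 1
    then show ?thesis using Suc.IH[of p] by simp
  next
    case (2 q)
    then show ?thesis using Suc.IH[of q] by (simp add: sg_a_def translate_def)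
  next
    case (3 q)
    then show ?thesis using Suc.IH[of q] by (simp add: sg_b_def translate_def)
  qed
qed

lemma sg_copies_meet:
  shows "sg_verts n \<inter> translate (sg_a n) ` sg_verts n = {sg_a n}"
    and "sg_verts n \<inter> translate (sg_b n) ` sg_verts n = {sg_b n}"
    and "translate (sg_a n) ` sg_verts n \<inter> translate (sg_b n) ` sg_verts n = {sg_c n}"
proof -
  have "translate (sg_a n) sg_o = sg_a n" "translate (sg_b n) sg_o = sg_b n"
    "translate (sg_a n) (sg_b n) = sg_c n" "translate (sg_b n) (sg_a n) = sg_c n"
    by (simp_all add: translate_def sg_o_def sg_a_def sg_b_def sg_c_def)
  then have mem: "sg_a n \<in> translate (sg_a n) ` sg_verts n"
    "sg_b n \<in> translate (sg_b n) ` sg_verts n"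
    "sg_c n \<in> translate (sg_a n) ` sg_verts n"
    "sg_c n \<in> translate (sg_b n) ` sg_verts n"
    using sg_outmost[of n] by (metis imageI)+
  have ta: "2 ^ n \<le> fst p \<and> fst p + snd p \<le> 2 * 2 ^ n"
    if p: "p \<in> translate (sg_a n) ` sg_verts n" for p
  proof -
    obtain q where "q \<in> sg_verts n" "p = translate (sg_a n) q" using p by blast
    then show ?thesis using sg_verts_bound[of q n] by (simp add: translate_def sg_a_def)
  qed
  have tb: "2 ^ n \<le> snd p \<and> fst p + snd p \<le> 2 * 2 ^ n"
    if p: "p \<in> translate (sg_b n) ` sg_verts n" for p
  proof -
    obtain q where "q \<in> sg_verts n" "p = translate (sg_b n) q" using p by blast
    then show ?thesis using sg_verts_bound[of q n] by (simp add: translate_def sg_b_def)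
  qed
  have "p = sg_a n" if "p \<in> sg_verts n" "p \<in> translate (sg_a n) ` sg_verts n" for p
    using sg_verts_bound[OF that(1)] ta[OF that(2)] by (simp add: sg_a_def prod_eq_iff)
  then show "sg_verts n \<inter> translate (sg_a n) ` sg_verts n = {sg_a n}"
    using sg_outmost[of n] mem by blast
  have "p = sg_b n" if "p \<in> sg_verts n" "p \<in> translate (sg_b n) ` sg_verts n" for p
    using sg_verts_bound[OF that(1)] tb[OF that(2)] by (simp add: sg_b_def prod_eq_iff)
  then show "sg_verts n \<inter> translate (sg_b n) ` sg_verts n = {sg_b n}"
    using sg_outmost[of n] mem by blast
  have "p = sg_c n"
    if "p \<in> translate (sg_a n) ` sg_verts n" "p \<in> translate (sg_b n) ` sg_verts n" for p
    using ta[OF that(1)] tb[OF that(2)] by (simp add: sg_c_def prod_eq_iff)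
  then show "translate (sg_a n) ` sg_verts n \<inter> translate (sg_b n) ` sg_verts n = {sg_c n}"
    using mem by blast
qed

text \<open>The numbers f, g, h of the subgraphs, and of those with exactly \<open>j\<close> edges at \<open>x\<close>.\<close>

definition f_count :: "nat \<Rightarrow> nat" where
  "f_count n = card (spanning_trees (sg_verts n) (sg_edges n))"

definition g_count :: "nat \<Rightarrow> nat" where
  "g_count n = card (two_tree_subgraphs (sg_verts n) (sg_edges n) sg_o (sg_a n) (sg_b n))"

definition h_count :: "nat \<Rightarrow> nat" where
  "h_count n = card (three_tree_subgraphs (sg_verts n) (sg_edges n) sg_o (sg_a n) (sg_b n))"

definition f_deg :: "nat \<Rightarrow> nat \<Rightarrow> vertex \<Rightarrow> nat" where
  "f_deg j n x = card {T \<in> spanning_trees (sg_verts n) (sg_edges n). edges_at T x = j}"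

definition g_deg :: "nat \<Rightarrow> nat \<Rightarrow> vertex \<Rightarrow> nat" where
  "g_deg j n x =
     card {T \<in> two_tree_subgraphs (sg_verts n) (sg_edges n) sg_o (sg_a n) (sg_b n). edges_at T x = j}"

definition h_deg :: "nat \<Rightarrow> nat \<Rightarrow> vertex \<Rightarrow> nat" where
  "h_deg j n x =
     card {T \<in> three_tree_subgraphs (sg_verts n) (sg_edges n) sg_o (sg_a n) (sg_b n). edges_at T x = j}"

definition F_prob :: "nat \<Rightarrow> nat \<Rightarrow> vertex \<Rightarrow> real" where
  "F_prob j n x = real (f_deg j n x) / real (f_count n)"

definition G_prob :: "nat \<Rightarrow> nat \<Rightarrow> vertex \<Rightarrow> real" where
  "G_prob j n x = real (g_deg j n x) / real (g_count n)"

definition H_prob :: "nat \<Rightarrow> nat \<Rightarrow> vertex \<Rightarrow> real" where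
  "H_prob j n x = real (h_deg j n x) / real (h_count n)"

text \<open>The reflection fixing \<open>o\<close> exchanges the two oblique coordinates (for every stage). The
  reflection of stage \<open>N\<close> fixing \<open>a\<^sub>N\<close> exchanges the second and third of the barycentric
  coordinates \<open>x\<close>, \<open>y\<close>, \<open>2^N - x - y\<close>.\<close>

definition refl_o :: "vertex \<Rightarrow> vertex" where
  "refl_o p = (snd p, fst p)"

definition refl_a :: "nat \<Rightarrow> vertex \<Rightarrow> vertex" where
  "refl_a N p = (fst p, 2 ^ N - fst p - snd p)"

lemma refl_o_simps:
  "refl_o sg_o = sg_o" "refl_o (sg_a k) = sg_b k" "refl_o (sg_b k) = sg_a k" "refl_o (sg_c k) = sg_c k"
  by (simp_all add: refl_o_def sg_o_def sg_a_def sg_b_def sg_c_def)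

lemma refl_a_simps:
  "refl_a N (sg_a N) = sg_a N" "refl_a N sg_o = sg_b N" "refl_a N (sg_b N) = sg_o"
  "refl_a (Suc k) (sg_a k) = sg_c k" "refl_a (Suc k) (sg_b k) = sg_b k"
  "refl_a (Suc k) (sg_c k) = sg_a k"
  by (simp_all add: refl_a_def sg_o_def sg_a_def sg_b_def sg_c_def)

text \<open>Midpoints of the bottom, left and right sides of the lower-right copy of stage \<open>k\<close> in
  stage \<open>k + 1\<close>. The integer division is exact for \<open>k \<ge> 1\<close>.\<close>

definition midpt :: "vertex \<Rightarrow> vertex \<Rightarrow> vertex" where
  "midpt p q = ((fst p + fst q) div 2, (snd p + snd q) div 2)"

definition sg_a1 :: "nat \<Rightarrow> vertex" where "sg_a1 k = midpt (sg_a k) (sg_a (Suc k))"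
definition sg_b1 :: "nat \<Rightarrow> vertex" where "sg_b1 k = midpt (sg_a k) (sg_c k)"
definition sg_c1 :: "nat \<Rightarrow> vertex" where "sg_c1 k = midpt (sg_a (Suc k)) (sg_c k)"

lemma sg_mid_translate:
  assumes "k = Suc i"
  shows "sg_a1 k = translate (sg_a k) (sg_a i)" "sg_b1 k = translate (sg_a k) (sg_b i)"
    "sg_c1 k = translate (sg_a k) (sg_c i)"
  using assms
  by (simp_all add: sg_a1_def sg_b1_def sg_c1_def midpt_def translate_def sg_a_def sg_b_def sg_c_def)

definition B_row :: "nat \<Rightarrow> nat \<Rightarrow> vertex \<Rightarrow> real list" where
  "B_row j N x = [F_prob j N x, G_prob j N x, G_prob j N (refl_o x), G_prob j N (refl_a N x),
     H_prob j N x]"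

definition B_mat :: "nat \<Rightarrow> nat \<Rightarrow> nat \<Rightarrow> real mat" where
  "B_mat j N k = mat_of_rows_list 5 [B_row j N (sg_a k), B_row j N (sg_b k), B_row j N (sg_c k)]"

definition L_mat :: "real mat" where
  "L_mat = mat_of_rows_list 5
    [[2/3, 3/5,  3/5,  3/5,  6/25],
     [1/6, 3/10, 1/10, 0,    7/50],
     [1/6, 1/10, 3/10, 1/10, 7/50],
     [0,   0,    0,    3/10, 6/25],
     [0,   0,    0,    0,    6/25]]"

definition R_mat :: "real mat" where
  "R_mat = mat_of_rows_list 5
    [[2/3, 3/5,  1/10, 3/5,  6/25],
     [1/6, 3/10, 1/10, 1/10, 7/50],
     [0,   0,    2/5,  0,    6/25],
     [1/6, 1/10, 1/10, 3/10, 7/50],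
     [0,   0,    3/10, 0,    6/25]]"

end

theory Submission
  imports Defs
begin

text \<open>The subgraphs counted by \<open>f\<close>, \<open>g\<close>, \<open>h\<close> are the spanning forests in which every vertex is
  joined to one of the three corners; they are classified by the partition of the corners into
  trees. Counting edges turns acyclicity into the equation \<open>|V| = blocks + |T|\<close>, so restricting a
  forest of stage \<open>n + 1\<close> to the three copies of stage \<open>n\<close> is a bijection onto triples whose types
  glue to the given type, which is a finite table. The table yields the recurrences for the counts,
  the relation \<open>f h = 3 g\<^sup>2\<close>, and from these the entries of the first three columns of \<open>L\<close> and \<open>R\<close>.
  The other columns play no role, because \<open>L\<close> maps the span of the first three unit vectors to
  itself.\<close>

subsection \<open>Counting components\<close>

text \<open>The obstacle is that acyclicity is not local: three forests may close a cycle through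
  the three shared vertices. An edge count is local. For a given corner type the number of edges has
  a minimum, attained exactly by the forests. Each part respects its own minimum, and by
  \<open>composes_blocks\<close> the whole attains its minimum only if every part does.

  The relation \<open>f h = 3 g^2\<close> makes the transition weights independent of the stage: for
  each target type with one or two blocks they become fixed multiples of one monomial,
  \<open>f^2 g\<close> or \<open>f g^2\<close>.

  The matrices act on coefficient vectors. A row of \<open>B_mat\<close> lists the probabilities of
  the five types at one vertex, the reflected \<open>G\<close> entries being \<open>Apart2\<close>
  and \<open>Apart1\<close>. Applying \<open>L_mat\<close> or \<open>R_mat\<close> to a column
  rewrites a linear combination of such probabilities one stage earlier, for a vertex seen in the
  lower-left or lower-right copy. Hence the rightmost factor of the power of \<open>L_mat\<close>
  belongs to the outermost stage.\<close>

lemma reachable_refl [simp]: "reachable E x x"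
  by (simp add: reachable_def)

lemma reachable_sym: "reachable E x y \<longleftrightarrow> reachable E y x"
proof -
  have "sym {(x, y). {x, y} \<in> E}"
    by (auto simp: sym_def insert_commute)
  then show ?thesis
    unfolding reachable_def by (meson sym_rtrancl symE)
qed

lemma reachable_trans: "reachable E x y \<Longrightarrow> reachable E y z \<Longrightarrow> reachable E x z"
  unfolding reachable_def by (rule rtrancl_trans)

lemma reachable_edge: "{x, y} \<in> E \<Longrightarrow> reachable E x y"
  unfolding reachable_def by auto

lemma reachable_mono: "reachable E x y \<Longrightarrow> E \<subseteq> E' \<Longrightarrow> reachable E' x y"
  unfolding reachable_def by (rule subsetD[OF rtrancl_mono]) auto

lemma reachable_induct [consumes 1, case_names refl step]:
  assumes "reachable E x y" and "P x"
    and "\<And>y z. reachable E x y \<Longrightarrow> {y, z} \<in> E \<Longrightarrow> P y \<Longrightarrow> P z"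
  shows "P y"
  using assms(1) unfolding reachable_def
  by (induction rule: rtrancl_induct) (use assms(2,3) in \<open>auto simp: reachable_def\<close>)

lemma reachable_closed:
  assumes "reachable E x y" "x \<in> C" "\<And>y z. {y, z} \<in> E \<Longrightarrow> y \<in> C \<Longrightarrow> z \<in> C"
  shows "y \<in> C"
  using assms(1) by (induction rule: reachable_induct) (use assms in auto)

lemma reachable_empty [simp]: "reachable {} x y \<longleftrightarrow> x = y"
  by (auto simp: reachable_def)

text \<open>A walk can be shortened until it crosses the new edge at most once, in one of two
  directions.\<close>

lemma reachable_insert:
  "reachable (insert {u, v} E) x y \<longleftrightarrow> reachable E x y
     \<or> reachable E x u \<and> reachable E v y \<or> reachable E x v \<and> reachable E u y"
    (is "?l \<longleftrightarrow> ?r x y")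
proof
  assume ?l
  then show "?r x y"
  proof (induction rule: reachable_induct)
    case (step y z)
    then consider "{y, z} \<in> E" | "y = u" "z = v" | "y = v" "z = u"
      by (auto simp: doubleton_eq_iff)
    then show ?case
      using step.IH by cases (meson reachable_edge reachable_trans reachable_refl)+
  qed simp
next
  have "reachable (insert {u, v} E) u v"
    by (rule reachable_edge) simp
  then show "?r x y \<Longrightarrow> ?l"
    by (meson reachable_mono reachable_trans reachable_sym subset_insertI)
qed

definition is_graph :: "'a set \<Rightarrow> 'a set set \<Rightarrow> bool" where
  "is_graph V E \<longleftrightarrow> finite V \<and> (\<forall>e\<in>E. \<exists>u\<in>V. \<exists>v\<in>V. u \<noteq> v \<and> e = {u, v})"

lemma is_graph_subset: "is_graph V E \<Longrightarrow> T \<subseteq> E \<Longrightarrow> is_graph V T"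
  by (auto simp: is_graph_def)

lemma is_graph_finite:
  assumes "is_graph V E"
  shows "finite V" "finite E"
proof -
  show "finite V" using assms by (simp add: is_graph_def)
  have "E \<subseteq> Pow V" using assms by (auto simp: is_graph_def)
  then show "finite E" using \<open>finite V\<close> finite_subset by blast
qed

lemma is_graph_edgeD:
  assumes "is_graph V E" "{u, v} \<in> E"
  shows "u \<in> V" "v \<in> V" "u \<noteq> v"
  using assms unfolding is_graph_def by (fastforce simp: doubleton_eq_iff)+

lemma reachable_in_graph: "is_graph V E \<Longrightarrow> reachable E x y \<Longrightarrow> x \<in> V \<Longrightarrow> y \<in> V"
  by (rule reachable_closed) (auto dest: is_graph_edgeD)

definition comp_of :: "'a set \<Rightarrow> 'a set set \<Rightarrow> 'a \<Rightarrow> 'a set" where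
  "comp_of V E u = {v \<in> V. reachable E u v}"

lemma components_image: "components V E = comp_of V E ` V"
  by (simp add: components_def comp_of_def image_def)

lemma comp_of_eq_iff:
  assumes "v \<in> V"
  shows "comp_of V E u = comp_of V E v \<longleftrightarrow> reachable E u v"
proof
  assume "comp_of V E u = comp_of V E v"
  moreover have "v \<in> comp_of V E v" using assms by (simp add: comp_of_def)
  ultimately have "v \<in> comp_of V E u" by simp
  then show "reachable E u v" by (simp add: comp_of_def)
next
  assume "reachable E u v"
  then show "comp_of V E u = comp_of V E v"
    unfolding comp_of_def by (meson reachable_sym reachable_trans)
qed

text \<open>An edge inside a component leaves reachability unchanged; an edge between two components
  merges these and leaves all others as they are. Every edge count below iterates this step.\<close>

lemma card_components_insert:
  assumes "finite V" "u \<in> V" "v \<in> V"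
  shows "card (components V E) =
    card (components V (insert {u, v} E)) + (if reachable E u v then 0 else 1)"
proof (cases "reachable E u v")
  case True
  then have "reachable (insert {u, v} E) x y = reachable E x y" for x y
    unfolding reachable_insert by (meson reachable_sym reachable_trans)
  with True show ?thesis by (simp add: components_def)
next
  case False
  let ?E = "insert {u, v} E"
  \<comment> \<open>The components that contain neither endpoint; they are the same before and after
    the insertion.\<close>
  let ?rest = "comp_of V E ` {x \<in> V. \<not> reachable E x u \<and> \<not> reachable E x v}"
  have fin: "finite ?rest" using assms(1) by simp
  have "components V E = insert (comp_of V E u) (insert (comp_of V E v) ?rest)"
  proof -
    have "comp_of V E x \<in> insert (comp_of V E u) (insert (comp_of V E v) ?rest)" if "x \<in> V" for x
      using that comp_of_eq_iff[OF assms(2), of E x] comp_of_eq_iff[OF assms(3), of E x] by auto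
    then show ?thesis using assms unfolding components_image by auto
  qed
  moreover have "comp_of V E u \<noteq> comp_of V E v"
    using False assms(3) by (simp add: comp_of_eq_iff)
  moreover have "comp_of V E u \<notin> ?rest" "comp_of V E v \<notin> ?rest"
    using comp_of_eq_iff[of _ V E] by (auto simp: reachable_sym)
  ultimately have 1: "card (components V E) = card ?rest + 2"
    using fin by simp
  have eq: "comp_of V ?E x = comp_of V E x" if "\<not> reachable E x u" "\<not> reachable E x v" for x
    using that unfolding comp_of_def reachable_insert by auto
  have uv: "comp_of V ?E x = comp_of V ?E u" if "reachable E x u \<or> reachable E x v" for x
    using that comp_of_eq_iff[OF assms(2), of ?E x] by (auto simp: reachable_insert)
  have "components V ?E = insert (comp_of V ?E u) ?rest"
  proof -
    have "comp_of V ?E x \<in> insert (comp_of V ?E u) ?rest" if "x \<in> V" for x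
      using that eq[of x] uv[of x] by auto
    moreover have "comp_of V E x \<in> components V ?E"
      if "x \<in> V" "\<not> reachable E x u" "\<not> reachable E x v" for x
      using that eq[of x] unfolding components_image by auto
    ultimately show ?thesis using assms unfolding components_image by auto
  qed
  moreover have "comp_of V ?E u \<notin> ?rest"
  proof
    assume "comp_of V ?E u \<in> ?rest"
    then obtain x where "x \<in> V" "\<not> reachable E x u" "comp_of V ?E u = comp_of V E x" by auto
    moreover have "u \<in> comp_of V ?E u" using assms by (simp add: comp_of_def)
    ultimately show False by (simp add: comp_of_def)
  qed
  ultimately have "card (components V ?E) = card ?rest + 1"
    using fin by simp
  with 1 False show ?thesis by simp
qed

lemma components_empty: "components V {} = (\<lambda>v. {v}) ` V"
  by (auto simp: components_def)

text \<open>Without edges there are \<open>card V\<close> components, and each edge lowers that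
  number by at most one.\<close>

lemma card_le_components:
  assumes "is_graph V E"
  shows "card V \<le> card (components V E) + card E"
  using is_graph_finite(2)[OF assms] assms
proof (induction E rule: finite_induct)
  case empty
  then show ?case by (simp add: components_empty card_image)
next
  case (insert e E)
  then obtain u v where "u \<in> V" "v \<in> V" "e = {u, v}"
    by (auto simp: is_graph_def)
  with insert card_components_insert[of V u v E] show ?case
    by (force simp: is_graph_def split: if_splits)
qed

lemma reachable_simple_path:
  assumes "reachable E u v"
  obtains p where "p \<noteq> []" "hd p = u" "last p = v" "distinct p"
    "successively (\<lambda>x y. {x, y} \<in> E) p"
proof -
  have "\<exists>p. p \<noteq> [] \<and> hd p = u \<and> last p = v \<and> distinct p \<and> successively (\<lambda>x y. {x, y} \<in> E) p"
    using assms
  proof (induction rule: reachable_induct)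
    case refl
    show ?case by (rule exI[of _ "[u]"]) simp
  next
    case (step y z)
    then obtain p where p: "p \<noteq> []" "hd p = u" "last p = y" "distinct p"
      "successively (\<lambda>x y. {x, y} \<in> E) p" by auto
    show ?case
    proof (cases "z \<in> set p")
      case True
      \<comment> \<open>The walk returns to a vertex already on the path, so the path is cut
        there.\<close>
      then obtain p1 p2 where "p = p1 @ z # p2" by (auto simp: in_set_conv_decomp)
      with p show ?thesis
        by (intro exI[of _ "p1 @ [z]"]) (auto simp: successively_append_iff hd_append)
    next
      case False
      with p step(2) show ?thesis
        by (intro exI[of _ "p @ [z]"]) (auto simp: successively_append_iff)
    qed
  qed
  then show thesis using that by blast
qed

text \<open>A simple path from \<open>u\<close> to \<open>v\<close> closes up with the edge
  \<open>{u, v}\<close>. The other two hypotheses exclude paths with one or two vertices, since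
  \<open>is_cycle\<close> asks for at least three.\<close>

lemma cycle_from_path:
  assumes "reachable E u v" "u \<noteq> v" "{u, v} \<notin> E"
  shows "\<exists>p. is_cycle (insert {u, v} E) p"
proof -
  obtain p where p: "p \<noteq> []" "hd p = u" "last p = v" "distinct p"
    "successively (\<lambda>x y. {x, y} \<in> E) p"
    using reachable_simple_path[OF assms(1)] .
  have len: "3 \<le> length p"
  proof (rule ccontr)
    assume "\<not> 3 \<le> length p"
    then have "length p = 1 \<or> length p = 2"
      using p(1) by (cases "length p") auto
    then consider x where "p = [x]" | x y where "p = [x, y]"
      by (auto simp: length_Suc_conv numeral_2_eq_2)
    then show False using p assms by cases auto
  qed
  have "{p ! i, p ! (Suc i mod length p)} \<in> insert {u, v} E" if "i < length p" for i
  proof (cases "Suc i < length p")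
    case True
    then show ?thesis using p(5) by (simp add: successively_conv_nth)
  next
    case False
    with that have "Suc i = length p" by simp
    then have "i = length p - 1" "Suc i mod length p = 0" by auto
    then show ?thesis using p by (simp add: hd_conv_nth last_conv_nth insert_commute)
  qed
  with p len show ?thesis unfolding is_cycle_def by blast
qed

lemma is_cycle_mono: "is_cycle E p \<Longrightarrow> E \<subseteq> E' \<Longrightarrow> is_cycle E' p"
  by (auto simp: is_cycle_def)

text \<open>By \<open>cycle_from_path\<close> every edge joins two different components of the rest,
  so each edge lowers the number of components by exactly one.\<close>

lemma acyclic_card:
  assumes "is_graph V E" "\<nexists>p. is_cycle E p"
  shows "card V = card (components V E) + card E"
  using is_graph_finite(2)[OF assms(1)] assms
proof (induction E rule: finite_induct)
  case empty
  then show ?case by (simp add: components_empty card_image)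
next
  case (insert e E)
  then obtain u v where e: "u \<in> V" "v \<in> V" "u \<noteq> v" "e = {u, v}"
    by (auto simp: is_graph_def)
  have "\<not> reachable E u v"
    using insert e cycle_from_path[of E u v] by blast
  moreover have "card V = card (components V E) + card E"
    using insert.IH insert.prems is_cycle_mono[of E _ "insert e E"] by (auto simp: is_graph_def)
  ultimately show ?case
    using insert e card_components_insert[of V u v E] by (auto simp: is_graph_def)
qed

text \<open>Deleting one edge of a cycle leaves its ends joined by the rest of the cycle. There are
  then as many components with one edge fewer, and \<open>card_le_components\<close> for the smaller
  graph makes the bound strict.\<close>

lemma cycle_card:
  assumes "is_graph V E" "is_cycle E p"
  shows "card V < card (components V E) + card E"
proof -
  let ?n = "length p"
  have p: "3 \<le> ?n" "distinct p" "\<And>i. i < ?n \<Longrightarrow> {p ! i, p ! (Suc i mod ?n)} \<in> E"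
    using assms(2) by (auto simp: is_cycle_def)
  let ?u = "p ! 0" and ?v = "p ! (?n - 1)"
  \<comment> \<open>The deleted edge leads from the last vertex of the cycle back to the first, so
    an induction along the list walks the long way round.\<close>
  let ?E = "E - {{?u, ?v}}"
  have "{?v, p ! (Suc (?n - 1) mod ?n)} \<in> E" using p(1) by (intro p(3)) auto
  then have e: "{?u, ?v} \<in> E"
    using p(1) by (subst insert_commute) (cases p, auto)
  have "reachable ?E ?u (p ! i)" if "i < ?n" for i
    using that
  proof (induction i)
    case (Suc i)
    have "{p ! i, p ! Suc i} \<in> E" using p(3)[of i] Suc.prems by simp
    moreover have "{p ! i, p ! Suc i} \<noteq> {?u, ?v}"
    proof
      assume "{p ! i, p ! Suc i} = {?u, ?v}"
      then consider "p ! i = ?u" "p ! Suc i = ?v" | "p ! i = ?v"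
        by (auto simp: doubleton_eq_iff)
      then show False
      proof cases
        \<comment> \<open>The edge would be the first of the list and the closing one at once, which
          forces a cycle of length two.\<close>
        case 1
        then have "i = 0" "Suc i = ?n - 1"
          using p(1) Suc.prems by (subst (asm) nth_eq_iff_index_eq[OF p(2)]; linarith)+
        with p(1) show False by simp
      next
        case 2
        then have "i = ?n - 1"
          using p(1) Suc.prems by (subst (asm) nth_eq_iff_index_eq[OF p(2)]; linarith)
        with Suc.prems show False by simp
      qed
    qed
    ultimately have "reachable ?E (p ! i) (p ! Suc i)" by (intro reachable_edge) simp
    moreover have "reachable ?E ?u (p ! i)" using Suc by simp
    ultimately show ?case by (rule reachable_trans[rotated])
  qed simp
  from this[of "?n - 1"] have "reachable ?E ?u ?v" using p(1) by simp
  moreover have "insert {?u, ?v} ?E = E" using e by auto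
  ultimately have "card (components V ?E) = card (components V E)"
    using card_components_insert[of V ?u ?v ?E] is_graph_edgeD[OF assms(1) e]
      is_graph_finite[OF assms(1)] by simp
  moreover have "card V \<le> card (components V ?E) + card ?E"
    using assms(1) by (intro card_le_components) (auto simp: is_graph_def)
  moreover have "card ?E < card E"
    using e is_graph_finite[OF assms(1)] by (intro psubset_card_mono) auto
  ultimately show ?thesis by simp
qed

lemma acyclic_iff_card:
  assumes "is_graph V E"
  shows "(\<nexists>p. is_cycle E p) \<longleftrightarrow> card V = card (components V E) + card E"
  using acyclic_card[OF assms] cycle_card[OF assms] by (metis less_irrefl)

text \<open>A cycle stays within one component, and a walk between vertices of a component uses only
  edges of that component.\<close>

lemma trees_iff_acyclic:
  assumes "is_graph V T"
  shows "(\<forall>C\<in>components V T. is_tree C (induced_edges T C)) \<longleftrightarrow> (\<nexists>p. is_cycle T p)"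
proof
  assume trees: "\<forall>C\<in>components V T. is_tree C (induced_edges T C)"
  show "\<nexists>p. is_cycle T p"
  proof
    assume "\<exists>p. is_cycle T p"
    then obtain p where p: "is_cycle T p" by blast
    let ?n = "length p" and ?C = "comp_of V T (p ! 0)"
    have n: "3 \<le> ?n" and pT: "\<And>i. i < ?n \<Longrightarrow> {p ! i, p ! (Suc i mod ?n)} \<in> T"
      using p by (auto simp: is_cycle_def)
    have r: "reachable T (p ! 0) (p ! i)" if "i < ?n" for i
      using that
    proof (induction i)
      case (Suc i)
      then show ?case
        using pT[of i] reachable_trans[OF _ reachable_edge] by fastforce
    qed simp
    have V: "p ! i \<in> V" if "i < ?n" for i
      using pT[OF that] is_graph_edgeD[OF assms] by blast
    have "{p ! i, p ! (Suc i mod ?n)} \<in> induced_edges T ?C" if "i < ?n" for i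
    proof -
      have "Suc i mod ?n < ?n" using n by (intro mod_less_divisor) linarith
      then show ?thesis
        using pT[OF that] r V that by (auto simp: induced_edges_def comp_of_def)
    qed
    then have "is_cycle (induced_edges T ?C) p"
      using p by (auto simp: is_cycle_def)
    moreover have "?C \<in> components V T"
      using V[of 0] n unfolding components_image by (intro imageI V) linarith
    ultimately show False using trees unfolding is_tree_def by blast
  qed
next
  assume acyclic: "\<nexists>p. is_cycle T p"
  show "\<forall>C\<in>components V T. is_tree C (induced_edges T C)"
  proof
    fix C
    assume "C \<in> components V T"
    then obtain x where x: "x \<in> V" "C = comp_of V T x" by (auto simp: components_image)
    have reach: "reachable (induced_edges T C) x y" if "y \<in> C" for y
    proof -
      have "reachable T x y" using that x by (simp add: comp_of_def)
      then show ?thesis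
      proof (induction rule: reachable_induct)
        case (step y z)
        then have "{y, z} \<in> induced_edges T C"
          using is_graph_edgeD[OF assms step(2)] x reachable_trans[OF step(1) reachable_edge[OF step(2)]]
          by (auto simp: induced_edges_def comp_of_def)
        then show ?case using step.IH reachable_edge reachable_trans by metis
      qed simp
    qed
    moreover have "x \<in> C" using x by (simp add: comp_of_def)
    moreover have "\<nexists>p. is_cycle (induced_edges T C) p"
      using acyclic is_cycle_mono[of "induced_edges T C" _ T] by (auto simp: induced_edges_def)
    ultimately show "is_tree C (induced_edges T C)"
      unfolding is_tree_def using reachable_sym reachable_trans by (metis empty_iff)
  qed
qed

subsection \<open>Forests attached to three corners\<close>

text \<open>\<open>Apart\<^sub>i\<close> means that the \<open>i\<close>-th corner is separated from the other two, which are joined. In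
  terms of the corners \<open>o\<close>, \<open>a\<^sub>n\<close>, \<open>b\<^sub>n\<close>, the types \<open>Joined\<close>, \<open>Apart3\<close>, \<open>Separate\<close> are counted by
  \<open>f\<close>, \<open>g\<close>, \<open>h\<close>.\<close>

datatype corner_type = Joined | Apart3 | Apart2 | Apart1 | Separate

fun link12 :: "corner_type \<Rightarrow> bool" where
  "link12 \<tau> \<longleftrightarrow> \<tau> = Joined \<or> \<tau> = Apart3"

fun link13 :: "corner_type \<Rightarrow> bool" where
  "link13 \<tau> \<longleftrightarrow> \<tau> = Joined \<or> \<tau> = Apart2"

fun link23 :: "corner_type \<Rightarrow> bool" where
  "link23 \<tau> \<longleftrightarrow> \<tau> = Joined \<or> \<tau> = Apart1"

fun blocks :: "corner_type \<Rightarrow> nat" where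
  "blocks Joined = 1"
| "blocks Separate = 3"
| "blocks _ = 2"

lemma UNIV_corner_type: "UNIV = {Joined, Apart3, Apart2, Apart1, Separate}"
  by (auto intro: corner_type.exhaust)

instance corner_type :: finite
  by standard (simp add: UNIV_corner_type)

text \<open>Cycles are allowed here. The first conjunct excludes components without a corner and the
  others fix the partition of the corners, so gluing can treat connectivity by logic and cycles by
  counting.\<close>

definition has_type :: "'a set \<Rightarrow> 'a set set \<Rightarrow> 'a \<Rightarrow> 'a \<Rightarrow> 'a \<Rightarrow> corner_type \<Rightarrow> bool" where
  "has_type V T p q r \<tau> \<longleftrightarrow>
     (\<forall>x\<in>V. reachable T x p \<or> reachable T x q \<or> reachable T x r) \<and>
     (reachable T p q \<longleftrightarrow> link12 \<tau>) \<and> (reachable T p r \<longleftrightarrow> link13 \<tau>) \<and>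
     (reachable T q r \<longleftrightarrow> link23 \<tau>)"

text \<open>Transitivity forbids that exactly two of the three pairs are joined, which leaves five
  partitions.\<close>

lemma has_type_exists:
  assumes "\<forall>x\<in>V. reachable T x p \<or> reachable T x q \<or> reachable T x r"
  obtains \<tau> where "has_type V T p q r \<tau>"
proof -
  have "reachable T p q \<Longrightarrow> reachable T p r \<Longrightarrow> reachable T q r"
    "reachable T p q \<Longrightarrow> reachable T q r \<Longrightarrow> reachable T p r"
    "reachable T p r \<Longrightarrow> reachable T q r \<Longrightarrow> reachable T p q"
    using reachable_trans[of T q p r] reachable_trans[of T p q r] reachable_trans[of T p r q]
    by (simp_all add: reachable_sym[of T q p] reachable_sym[of T r q])
  then have "has_type V T p q r (if reachable T p q then if reachable T p r then Joined else Apart3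
      else if reachable T p r then Apart2 else if reachable T q r then Apart1 else Separate)"
    using assms by (auto simp: has_type_def)
  then show thesis by (rule that)
qed

lemma has_type_unique: "has_type V T p q r \<tau> \<Longrightarrow> has_type V T p q r \<tau>' \<Longrightarrow> \<tau> = \<tau>'"
  by (cases \<tau>; cases \<tau>'; simp add: has_type_def)

definition corner_forests ::
  "'a set \<Rightarrow> 'a set set \<Rightarrow> 'a \<Rightarrow> 'a \<Rightarrow> 'a \<Rightarrow> corner_type \<Rightarrow> 'a set set set" where
  "corner_forests V E p q r \<tau> = {T. T \<subseteq> E \<and> has_type V T p q r \<tau> \<and> card V = blocks \<tau> + card T}"

lemma finite_corner_forests: "finite E \<Longrightarrow> finite (corner_forests V E p q r \<tau>)"
  by (rule finite_subset[of _ "Pow E"]) (auto simp: corner_forests_def)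

lemma has_type_components:
  assumes "has_type V T p q r \<tau>" "p \<in> V" "q \<in> V" "r \<in> V"
  shows "components V T = {comp_of V T p, comp_of V T q, comp_of V T r}"
proof -
  have "comp_of V T x \<in> {comp_of V T p, comp_of V T q, comp_of V T r}" if "x \<in> V" for x
  proof -
    have "reachable T x p \<or> reachable T x q \<or> reachable T x r"
      using assms(1) that by (simp add: has_type_def)
    then show ?thesis using assms(2-) by (auto simp: comp_of_eq_iff)
  qed
  then show ?thesis using assms unfolding components_image by auto
qed

lemma has_type_card_components:
  assumes "has_type V T p q r \<tau>" "p \<in> V" "q \<in> V" "r \<in> V"
  shows "card (components V T) = blocks \<tau>"
proof -
  have "comp_of V T p = comp_of V T q \<longleftrightarrow> link12 \<tau>" "comp_of V T p = comp_of V T r \<longleftrightarrow> link13 \<tau>"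
    "comp_of V T q = comp_of V T r \<longleftrightarrow> link23 \<tau>"
    using assms by (simp_all add: comp_of_eq_iff has_type_def)
  then show ?thesis
    unfolding has_type_components[OF assms] by (cases \<tau>) (simp_all add: card_insert_if)
qed

text \<open>Every component contains a corner, so there are \<open>blocks \<tau>\<close> of them,
  and the equation in \<open>corner_forests\<close> is the criterion
  \<open>acyclic_iff_card\<close>.\<close>

lemma corner_forests_iff_acyclic:
  assumes "is_graph V E" "p \<in> V" "q \<in> V" "r \<in> V"
  shows "T \<in> corner_forests V E p q r \<tau> \<longleftrightarrow>
    T \<subseteq> E \<and> has_type V T p q r \<tau> \<and> (\<forall>C\<in>components V T. is_tree C (induced_edges T C))"
  using assms has_type_card_components[of V T p q r \<tau>]
    acyclic_iff_card[OF is_graph_subset[OF assms(1)], of T]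
    trees_iff_acyclic[OF is_graph_subset[OF assms(1)], of T]
  unfolding corner_forests_def by auto

lemma comp_of_unique:
  assumes "C \<in> components V T" "x \<in> C"
  shows "C = comp_of V T x"
proof -
  obtain y where "y \<in> V" "C = comp_of V T y"
    using assms(1) by (auto simp: components_image)
  with assms(2) show ?thesis using comp_of_eq_iff[of x V T y] by (simp add: comp_of_def)
qed

text \<open>Spanning trees are defined without components; this puts them into the form of the two-
  and three-tree subgraphs, which \<open>corner_forests_iff_acyclic\<close> handles.\<close>

lemma is_tree_iff_components:
  assumes "\<forall>e\<in>T. e \<subseteq> V"
  shows "is_tree V T \<longleftrightarrow> components V T = {V} \<and> is_tree V (induced_edges T V)"
proof -
  have "induced_edges T V = T" using assms by (auto simp: induced_edges_def)
  moreover have "components V T = {V}" if "is_tree V T"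
    using that by (auto simp: components_def is_tree_def)
  ultimately show ?thesis by auto
qed

lemma spanning_trees_eq:
  assumes "is_graph V E" "p \<in> V" "q \<in> V" "r \<in> V"
  shows "spanning_trees V E = corner_forests V E p q r Joined"
proof -
  have "is_tree V T \<longleftrightarrow> has_type V T p q r Joined \<and>
      (\<forall>C\<in>components V T. is_tree C (induced_edges T C))" if "T \<subseteq> E" for T
  proof -
    have T: "is_tree V T \<longleftrightarrow> components V T = {V} \<and> is_tree V (induced_edges T V)"
      using that assms(1) by (intro is_tree_iff_components) (auto simp: is_graph_def)
    have "components V T = {V}" if "has_type V T p q r Joined"
    proof -
      have "comp_of V T q = comp_of V T p" "comp_of V T r = comp_of V T p"
        using that assms by (auto simp: comp_of_eq_iff has_type_def reachable_sym)
      then have "components V T = {comp_of V T p}"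
        using has_type_components[OF that assms(2-)] by simp
      moreover have "x \<in> comp_of V T p" if "x \<in> V" for x
      proof -
        have "reachable T x p \<or> reachable T x q \<or> reachable T x r"
          "reachable T p q" "reachable T p r"
          using \<open>has_type V T p q r Joined\<close> that by (auto simp: has_type_def)
        then have "reachable T p x" by (meson reachable_sym reachable_trans)
        with that show ?thesis by (simp add: comp_of_def)
      qed
      ultimately show ?thesis by (auto simp: comp_of_def)
    qed
    moreover have "has_type V T p q r Joined" if "is_tree V T"
      using that assms by (auto simp: is_tree_def has_type_def)
    ultimately show ?thesis using T by auto
  qed
  then show ?thesis
    using corner_forests_iff_acyclic[OF assms] by (auto simp: spanning_trees_def)
qed

lemma two_tree_subgraphs_eq:
  assumes "is_graph V E" "p \<in> V" "q \<in> V" "r \<in> V"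
  shows "two_tree_subgraphs V E p q r = corner_forests V E p q r Apart3" (is "?l = ?r")
proof (intro equalityI subsetI)
  fix T
  assume "T \<in> ?l"
  then obtain C D where T: "T \<subseteq> E" "C \<noteq> D" "components V T = {C, D}"
    "is_tree C (induced_edges T C)" "is_tree D (induced_edges T D)" "p \<in> C" "q \<in> C" "r \<in> D"
    by (auto simp: two_tree_subgraphs_def)
  have C: "C = comp_of V T p" "C = comp_of V T q" and D: "D = comp_of V T r"
    using T comp_of_unique[of _ V T] by auto
  have "comp_of V T x = C \<or> comp_of V T x = D" if "x \<in> V" for x
    using T(3) that unfolding components_image by auto
  then have "\<forall>x\<in>V. reachable T x p \<or> reachable T x q \<or> reachable T x r"
    using C D assms comp_of_eq_iff[of _ V T] by metis
  moreover have "reachable T p q" "\<not> reachable T p r" "\<not> reachable T q r"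
    using C D T(2) assms comp_of_eq_iff[of _ V T] by metis+
  ultimately have "has_type V T p q r Apart3" by (simp add: has_type_def)
  then show "T \<in> ?r"
    using T by (simp add: corner_forests_iff_acyclic[OF assms])
next
  fix T
  assume "T \<in> ?r"
  then have T: "T \<subseteq> E" "has_type V T p q r Apart3"
    "\<forall>C\<in>components V T. is_tree C (induced_edges T C)"
    by (auto simp: corner_forests_iff_acyclic[OF assms])
  have "comp_of V T p = comp_of V T q" "comp_of V T p \<noteq> comp_of V T r"
    using T(2) assms by (auto simp: has_type_def comp_of_eq_iff)
  moreover have "p \<in> comp_of V T p" "q \<in> comp_of V T q" "r \<in> comp_of V T r"
    using assms by (simp_all add: comp_of_def)
  moreover have "components V T = {comp_of V T p, comp_of V T r}"
    using calculation(1) has_type_components[OF T(2) assms(2-)] by simp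
  ultimately show "T \<in> ?l"
    using T(1,3) unfolding two_tree_subgraphs_def mem_Collect_eq
    by (intro conjI exI[of _ "comp_of V T p"] exI[of _ "comp_of V T r"]) simp_all
qed

lemma three_tree_subgraphs_eq:
  assumes "is_graph V E" "p \<in> V" "q \<in> V" "r \<in> V"
  shows "three_tree_subgraphs V E p q r = corner_forests V E p q r Separate" (is "?l = ?r")
proof (intro equalityI subsetI)
  fix T
  assume "T \<in> ?l"
  then obtain A C D where T: "T \<subseteq> E" "A \<noteq> C" "A \<noteq> D" "C \<noteq> D" "components V T = {A, C, D}"
    "is_tree A (induced_edges T A)" "is_tree C (induced_edges T C)" "is_tree D (induced_edges T D)"
    "p \<in> A" "q \<in> C" "r \<in> D"
    by (auto simp: three_tree_subgraphs_def)
  have C: "A = comp_of V T p" "C = comp_of V T q" "D = comp_of V T r"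
    using T comp_of_unique[of _ V T] by auto
  have "comp_of V T x = A \<or> comp_of V T x = C \<or> comp_of V T x = D" if "x \<in> V" for x
    using T(5) that unfolding components_image by auto
  then have "\<forall>x\<in>V. reachable T x p \<or> reachable T x q \<or> reachable T x r"
    using C assms comp_of_eq_iff[of _ V T] by metis
  moreover have "\<not> reachable T p q" "\<not> reachable T p r" "\<not> reachable T q r"
    using C T(2-4) assms comp_of_eq_iff[of _ V T] by metis+
  ultimately have "has_type V T p q r Separate" by (simp add: has_type_def)
  then show "T \<in> ?r"
    using T by (simp add: corner_forests_iff_acyclic[OF assms])
next
  fix T
  assume "T \<in> ?r"
  then have T: "T \<subseteq> E" "has_type V T p q r Separate"
    "\<forall>C\<in>components V T. is_tree C (induced_edges T C)"
    by (auto simp: corner_forests_iff_acyclic[OF assms])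
  have "comp_of V T p \<noteq> comp_of V T q" "comp_of V T p \<noteq> comp_of V T r"
    "comp_of V T q \<noteq> comp_of V T r"
    using T(2) assms by (auto simp: has_type_def comp_of_eq_iff)
  moreover have "p \<in> comp_of V T p" "q \<in> comp_of V T q" "r \<in> comp_of V T r"
    using assms by (simp_all add: comp_of_def)
  ultimately show "T \<in> ?l"
    using T(1,3) has_type_components[OF T(2) assms(2-)]
    unfolding three_tree_subgraphs_def mem_Collect_eq
    by (intro conjI exI[of _ "comp_of V T p"] exI[of _ "comp_of V T q"] exI[of _ "comp_of V T r"])
      simp_all
qed

text \<open>The half of the edge count that survives cycles; it bounds the parts from below in
  \<open>corner_forests_glue_iff\<close>.\<close>

lemma has_type_card_le:
  assumes "is_graph V T" "has_type V T p q r \<tau>" "p \<in> V" "q \<in> V" "r \<in> V"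
  shows "card V \<le> blocks \<tau> + card T"
  using card_le_components[OF assms(1)] has_type_card_components[OF assms(2-)] by simp

subsection \<open>Gluing three graphs\<close>

text \<open>A family is used so that one argument covers all three copies. As \<open>overlap\<close>
  holds for both orders of the indices, a vertex common to two parts is a corner of each.\<close>

locale gluing =
  fixes I :: "'i set" and V :: "'i \<Rightarrow> 'a set" and T :: "'i \<Rightarrow> 'a set set" and K :: "'i \<Rightarrow> 'a set"
  assumes graph: "i \<in> I \<Longrightarrow> is_graph (V i) (T i)"
    and corners: "i \<in> I \<Longrightarrow> K i \<subseteq> V i"
    and overlap: "i \<in> I \<Longrightarrow> k \<in> I \<Longrightarrow> i \<noteq> k \<Longrightarrow> V i \<inter> V k \<subseteq> K i"
begin

text \<open>The first edge from another part starts at a vertex of two parts, hence at a corner;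
  until then the walk stays in \<open>T i\<close>.\<close>

lemma reachable_exit:
  assumes "reachable (\<Union>(T ` I)) x y" "i \<in> I" "x \<in> V i"
  shows "reachable (T i) x y \<or> (\<exists>t\<in>K i. reachable (T i) x t)"
  using assms(1)
proof (induction rule: reachable_induct)
  case (step y z)
  then obtain k where k: "k \<in> I" "{y, z} \<in> T k" by auto
  show ?case
  proof (cases "\<exists>t\<in>K i. reachable (T i) x t")
    case False
    then have y: "reachable (T i) x y" using step.IH by simp
    then have "y \<in> V i" using assms graph reachable_in_graph by metis
    moreover have "y \<in> V k" using is_graph_edgeD[OF graph] k by metis
    ultimately have "k = i" using overlap[of i k] k assms(2) y False by blast
    then show ?thesis using k reachable_trans[OF y reachable_edge] by auto
  qed simp
qed simp

text \<open>A walk changes parts only at corners, so closure under the connections inside single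
  parts is enough to trap it. This serves to show that corners are not joined.\<close>

lemma reachable_closed_corners:
  assumes closed: "\<And>i s t. i \<in> I \<Longrightarrow> s \<in> Z \<Longrightarrow> s \<in> K i \<Longrightarrow> t \<in> K i \<Longrightarrow> reachable (T i) s t \<Longrightarrow> t \<in> Z"
    and "reachable (\<Union>(T ` I)) x y" "x \<in> Z" "k \<in> I" "x \<in> K k" "l \<in> I" "y \<in> K l"
  shows "y \<in> Z"
proof -
  \<comment> \<open>Invariant: the current vertex is joined, inside a single part, to a corner in
    \<open>Z\<close>.\<close>
  have "\<exists>i\<in>I. \<exists>t\<in>Z \<inter> K i. reachable (T i) t y"
    using assms(2)
  proof (induction rule: reachable_induct)
    case refl
    show ?case using assms(3-5) by (intro bexI[of _ k] bexI[of _ x]) auto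
  next
    case (step y z)
    then obtain m where m: "m \<in> I" "{y, z} \<in> T m" by auto
    obtain i t where i: "i \<in> I" "t \<in> Z" "t \<in> K i" "reachable (T i) t y"
      using step.IH by auto
    show ?case
    proof (cases "m = i")
      case True
      then have "reachable (T i) t z" using i m reachable_trans[OF i(4) reachable_edge] by auto
      then show ?thesis using i by auto
    next
      \<comment> \<open>The walk passes from part \<open>i\<close> to part \<open>m\<close> at
        \<open>y\<close>, which is a corner of both; closure puts it into \<open>Z\<close>.\<close>
      case False
      have "y \<in> V i" using i corners graph reachable_in_graph by (metis subsetD)
      moreover have "y \<in> V m" using is_graph_edgeD[OF graph] m by metis
      ultimately have "y \<in> K i" "y \<in> K m" using overlap i(1) m(1) False by blast+
      then have "y \<in> Z" using closed i by blast
      then show ?thesis using m \<open>y \<in> K m\<close> reachable_edge by (metis IntI)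
    qed
  qed
  then obtain i t where i: "i \<in> I" "t \<in> Z" "t \<in> K i" "reachable (T i) t y" by auto
  have "y \<in> V i" using i corners graph reachable_in_graph by (metis subsetD)
  then have "y \<in> K i"
    using overlap[of i l] i(1) assms(6,7) corners[of l] by (cases "i = l") auto
  then show ?thesis using closed i by blast
qed

end

text \<open>Three graphs with corners \<open>(u, a, b)\<close>, \<open>(a, v, c)\<close>, \<open>(b, c, w)\<close> carry forests of types
  \<open>\<alpha>\<close>, \<open>\<beta>\<close>, \<open>\<gamma>\<close>. Below, \<open>ab\<close> is the statement that \<open>a\<close> and \<open>b\<close> are joined in the union, and so on: a
  connection between two shared vertices is direct or goes through the third one, and a connection
  from an outer corner starts in its own copy.\<close>

definition composes ::
  "corner_type \<Rightarrow> corner_type \<Rightarrow> corner_type \<Rightarrow> corner_type \<Rightarrow> bool" where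
  "composes \<alpha> \<beta> \<gamma> \<tau> \<longleftrightarrow>
    (let ab = link23 \<alpha> \<or> link13 \<beta> \<and> link12 \<gamma>;
         ac = link13 \<beta> \<or> link23 \<alpha> \<and> link12 \<gamma>;
         bc = link12 \<gamma> \<or> link23 \<alpha> \<and> link13 \<beta>;
         ua = link12 \<alpha> \<or> link13 \<alpha> \<and> ab;
         ub = link13 \<alpha> \<or> link12 \<alpha> \<and> ab;
         uc = link12 \<alpha> \<and> ac \<or> link13 \<alpha> \<and> bc;
         va = link12 \<beta> \<or> link23 \<beta> \<and> ac;
         vb = link12 \<beta> \<and> ab \<or> link23 \<beta> \<and> bc;
         vc = link23 \<beta> \<or> link12 \<beta> \<and> ac;
         wa = link13 \<gamma> \<and> ab \<or> link23 \<gamma> \<and> ac;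
         wb = link13 \<gamma> \<or> link23 \<gamma> \<and> bc;
         wc = link23 \<gamma> \<or> link13 \<gamma> \<and> bc
     in (ua \<or> va \<or> wa) \<and> (ub \<or> vb \<or> wb) \<and> (uc \<or> vc \<or> wc) \<and>
        ((ua \<and> link12 \<beta> \<or> uc \<and> link23 \<beta>) \<longleftrightarrow> link12 \<tau>) \<and>
        ((ub \<and> link13 \<gamma> \<or> uc \<and> link23 \<gamma>) \<longleftrightarrow> link13 \<tau>) \<and>
        ((vb \<and> link13 \<gamma> \<or> vc \<and> link23 \<gamma>) \<longleftrightarrow> link23 \<tau>))"

text \<open>Equality is the case in which no cycle arises through the shared vertices.\<close>

lemma composes_blocks:
  "composes \<alpha> \<beta> \<gamma> \<tau> \<Longrightarrow> blocks \<alpha> + blocks \<beta> + blocks \<gamma> \<le> 3 + blocks \<tau>"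
  unfolding composes_def Let_def by (cases \<alpha>; cases \<beta>; cases \<gamma>; cases \<tau>; simp)

definition glues ::
  "corner_type \<Rightarrow> corner_type \<Rightarrow> corner_type \<Rightarrow> corner_type \<Rightarrow> bool" where
  "glues \<alpha> \<beta> \<gamma> \<tau> \<longleftrightarrow>
     composes \<alpha> \<beta> \<gamma> \<tau> \<and> blocks \<alpha> + blocks \<beta> + blocks \<gamma> = 3 + blocks \<tau>"

lemma link_trans:
  "link12 \<tau> \<Longrightarrow> link13 \<tau> \<Longrightarrow> link23 \<tau>" "link12 \<tau> \<Longrightarrow> link23 \<tau> \<Longrightarrow> link13 \<tau>"
  "link13 \<tau> \<Longrightarrow> link23 \<tau> \<Longrightarrow> link12 \<tau>"
  by auto

text \<open>A common edge would have two different ends, both in the one-point intersection.\<close>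

lemma is_graph_edges_disjoint:
  assumes "is_graph V E" "is_graph V' E'" "V \<inter> V' = {x}"
  shows "E \<inter> E' = {}"
proof -
  have False if e: "e \<in> E" "e \<in> E'" for e
  proof -
    have "\<exists>p\<in>V. \<exists>q\<in>V. p \<noteq> q \<and> e = {p, q}"
      using assms(1) e(1) by (simp add: is_graph_def)
    then obtain p q where pq: "p \<in> V" "q \<in> V" "p \<noteq> q" "e = {p, q}" by blast
    then have "p \<in> V'" "q \<in> V'" using is_graph_edgeD[OF assms(2)] e(2) by blast+
    with pq assms(3) show False by (metis IntI singletonD)
  qed
  then show ?thesis by blast
qed

text \<open>The corners of the parts will be listed as \<open>(u, a, b)\<close>,
  \<open>(a, v, c)\<close>, \<open>(b, c, w)\<close>. In the gasket these are the translates of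
  \<open>(sg_o, sg_a n, sg_b n)\<close> in this order, so one count per type serves all three
  copies.\<close>

locale triangle_gluing =
  fixes V1 V2 V3 :: "'a set" and E1 E2 E3 :: "'a set set" and u v w a b c :: 'a
  assumes graphs: "is_graph V1 E1" "is_graph V2 E2" "is_graph V3 E3"
    and corners: "u \<in> V1" "v \<in> V2" "w \<in> V3"
    and meet: "V1 \<inter> V2 = {a}" "V1 \<inter> V3 = {b}" "V2 \<inter> V3 = {c}"
    and distinct_corners: "distinct [u, v, w, a, b, c]"
begin

lemma shared_corners: "a \<in> V1" "a \<in> V2" "b \<in> V1" "b \<in> V3" "c \<in> V2" "c \<in> V3"
  using meet by auto

lemma edges_disjoint: "E1 \<inter> E2 = {}" "E1 \<inter> E3 = {}" "E2 \<inter> E3 = {}"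
  using is_graph_edges_disjoint graphs meet by metis+

text \<open>Each of the three identifications removes one vertex; this is the 3 in
  \<open>glues\<close>.\<close>

lemma card_vertices: "card (V1 \<union> V2 \<union> V3) + 3 = card V1 + card V2 + card V3"
proof -
  have fin: "finite V1" "finite V2" "finite V3" using graphs by (simp_all add: is_graph_def)
  have "(V1 \<union> V2) \<inter> V3 = {b, c}" using meet by auto
  moreover have "b \<noteq> c" using distinct_corners by simp
  ultimately show ?thesis
    using card_Un_Int[of V1 V2] card_Un_Int[of "V1 \<union> V2" V3] fin meet by simp
qed

context
  fixes T1 T2 T3 T
  assumes sub: "T1 \<subseteq> E1" "T2 \<subseteq> E2" "T3 \<subseteq> E3"
    and T: "T = T1 \<union> T2 \<union> T3"
begin

lemma gluing: "gluing {0, 1, 2::nat} ((!) [V1, V2, V3]) ((!) [T1, T2, T3])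
    ((!) [{u, a, b}, {a, v, c}, {b, c, w}])"
proof
  fix i :: nat
  assume "i \<in> {0, 1, 2}"
  then show "is_graph ([V1, V2, V3] ! i) ([T1, T2, T3] ! i)"
    using graphs sub is_graph_subset by auto
  show "[{u, a, b}, {a, v, c}, {b, c, w}] ! i \<subseteq> [V1, V2, V3] ! i"
    using \<open>i \<in> {0, 1, 2}\<close> corners shared_corners by auto
  fix k :: nat
  assume "k \<in> {0, 1, 2}" "i \<noteq> k"
  then show "[V1, V2, V3] ! i \<inter> [V1, V2, V3] ! k \<subseteq> [{u, a, b}, {a, v, c}, {b, c, w}] ! i"
    using \<open>i \<in> {0, 1, 2}\<close> meet by auto
qed

lemma union_parts: "\<Union> ((!) [T1, T2, T3] ` {0, 1, 2::nat}) = T"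
  by (simp add: T Un_assoc)

lemma reachable_parts: "reachable T1 x y \<Longrightarrow> reachable T x y" "reachable T2 x y \<Longrightarrow> reachable T x y"
  "reachable T3 x y \<Longrightarrow> reachable T x y"
  by (auto simp: T elim: reachable_mono)

text \<open>A walk to an outer corner either arrives there inside the part where it starts or first
  meets a corner of that part.\<close>

lemma attached_parts:
  assumes "has_type (V1 \<union> V2 \<union> V3) T u v w \<tau>"
  shows "\<forall>x\<in>V1. reachable T1 x u \<or> reachable T1 x a \<or> reachable T1 x b"
    "\<forall>x\<in>V2. reachable T2 x a \<or> reachable T2 x v \<or> reachable T2 x c"
    "\<forall>x\<in>V3. reachable T3 x b \<or> reachable T3 x c \<or> reachable T3 x w"
proof -
  interpret gluing "{0, 1, 2::nat}" "(!) [V1, V2, V3]" "(!) [T1, T2, T3]"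
    "(!) [{u, a, b}, {a, v, c}, {b, c, w}]"
    by (rule gluing)
  have "\<exists>t\<in>[{u, a, b}, {a, v, c}, {b, c, w}] ! i. reachable ([T1, T2, T3] ! i) x t"
    if i: "i \<in> {0, 1, 2}" and x: "x \<in> [V1, V2, V3] ! i" for i :: nat and x
  proof -
    have "x \<in> V1 \<union> V2 \<union> V3" using i x by auto
    then obtain y k where y: "reachable T x y" "k \<in> {0, 1, 2::nat}"
      "y \<in> [{u, a, b}, {a, v, c}, {b, c, w}] ! k"
      using assms by (fastforce simp: has_type_def)
    then consider "reachable ([T1, T2, T3] ! i) x y"
      | "\<exists>t\<in>[{u, a, b}, {a, v, c}, {b, c, w}] ! i. reachable ([T1, T2, T3] ! i) x t"
      using reachable_exit[of x y i] i x by (auto simp only: union_parts)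
    then show ?thesis
    proof cases
      \<comment> \<open>\<open>y\<close> is a corner of part \<open>k\<close> that lies in part
        \<open>i\<close>, hence it is also a corner of part \<open>i\<close>.\<close>
      case 1
      then have "y \<in> [V1, V2, V3] ! i"
        using graph[OF i] x reachable_in_graph by metis
      moreover have "y \<in> [V1, V2, V3] ! k"
        using y corners[OF y(2)] by blast
      ultimately have "y \<in> [{u, a, b}, {a, v, c}, {b, c, w}] ! i"
        using overlap[OF i y(2)] y(3) by (cases "i = k") auto
      with 1 show ?thesis by blast
    qed
  qed
  from this[of 0] this[of 1] this[of 2] show
    "\<forall>x\<in>V1. reachable T1 x u \<or> reachable T1 x a \<or> reachable T1 x b"
    "\<forall>x\<in>V2. reachable T2 x a \<or> reachable T2 x v \<or> reachable T2 x c"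
    "\<forall>x\<in>V3. reachable T3 x b \<or> reachable T3 x c \<or> reachable T3 x w"
    by auto
qed

text \<open>Each formula of \<open>composes\<close> is matched from two sides. Explicit walks
  realise it; and the set of corners that the formulas attach to an outer corner is closed within
  every part, so no walk escapes from it.\<close>

lemma has_type_glue:
  assumes types: "has_type V1 T1 u a b \<alpha>" "has_type V2 T2 a v c \<beta>" "has_type V3 T3 b c w \<gamma>"
  shows "has_type (V1 \<union> V2 \<union> V3) T u v w \<tau> \<longleftrightarrow> composes \<alpha> \<beta> \<gamma> \<tau>"
proof -
  interpret gluing "{0, 1, 2::nat}" "(!) [V1, V2, V3]" "(!) [T1, T2, T3]"
    "(!) [{u, a, b}, {a, v, c}, {b, c, w}]"
    by (rule gluing)
  \<comment> \<open>The links stay opaque, so that the goals below are propositional in nine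
    letters.\<close>
  note [simp del] = link12.simps link13.simps link23.simps
  have r1: "reachable T1 u a \<longleftrightarrow> link12 \<alpha>" "reachable T1 u b \<longleftrightarrow> link13 \<alpha>" "reachable T1 a b \<longleftrightarrow> link23 \<alpha>"
    "reachable T2 a v \<longleftrightarrow> link12 \<beta>" "reachable T2 a c \<longleftrightarrow> link13 \<beta>" "reachable T2 v c \<longleftrightarrow> link23 \<beta>"
    "reachable T3 b c \<longleftrightarrow> link12 \<gamma>" "reachable T3 b w \<longleftrightarrow> link13 \<gamma>" "reachable T3 c w \<longleftrightarrow> link23 \<gamma>"
    using types unfolding has_type_def by blast+
  have r2: "reachable T1 a u \<longleftrightarrow> link12 \<alpha>" "reachable T1 b u \<longleftrightarrow> link13 \<alpha>" "reachable T1 b a \<longleftrightarrow> link23 \<alpha>"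
    "reachable T2 v a \<longleftrightarrow> link12 \<beta>" "reachable T2 c a \<longleftrightarrow> link13 \<beta>" "reachable T2 c v \<longleftrightarrow> link23 \<beta>"
    "reachable T3 c b \<longleftrightarrow> link12 \<gamma>" "reachable T3 w b \<longleftrightarrow> link13 \<gamma>" "reachable T3 w c \<longleftrightarrow> link23 \<gamma>"
    unfolding r1[symmetric] by (rule reachable_sym)+
  note links = link_trans[of \<alpha>] link_trans[of \<beta>] link_trans[of \<gamma>]
  define ab where "ab \<longleftrightarrow> link23 \<alpha> \<or> link13 \<beta> \<and> link12 \<gamma>"
  define ac where "ac \<longleftrightarrow> link13 \<beta> \<or> link23 \<alpha> \<and> link12 \<gamma>"
  define bc where "bc \<longleftrightarrow> link12 \<gamma> \<or> link23 \<alpha> \<and> link13 \<beta>"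
  define ua where "ua \<longleftrightarrow> link12 \<alpha> \<or> link13 \<alpha> \<and> ab"
  define ub where "ub \<longleftrightarrow> link13 \<alpha> \<or> link12 \<alpha> \<and> ab"
  define uc where "uc \<longleftrightarrow> link12 \<alpha> \<and> ac \<or> link13 \<alpha> \<and> bc"
  define va where "va \<longleftrightarrow> link12 \<beta> \<or> link23 \<beta> \<and> ac"
  define vb where "vb \<longleftrightarrow> link12 \<beta> \<and> ab \<or> link23 \<beta> \<and> bc"
  define vc where "vc \<longleftrightarrow> link23 \<beta> \<or> link12 \<beta> \<and> ac"
  define wa where "wa \<longleftrightarrow> link13 \<gamma> \<and> ab \<or> link23 \<gamma> \<and> ac"
  define wb where "wb \<longleftrightarrow> link13 \<gamma> \<or> link23 \<gamma> \<and> bc"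
  define wc where "wc \<longleftrightarrow> link23 \<gamma> \<or> link13 \<gamma> \<and> bc"
  define uv where "uv \<longleftrightarrow> ua \<and> link12 \<beta> \<or> uc \<and> link23 \<beta>"
  define uw where "uw \<longleftrightarrow> ub \<and> link13 \<gamma> \<or> uc \<and> link23 \<gamma>"
  define vw where "vw \<longleftrightarrow> vb \<and> link13 \<gamma> \<or> vc \<and> link23 \<gamma>"
  note defs = ab_def ac_def bc_def ua_def ub_def uc_def va_def vb_def vc_def wa_def wb_def wc_def
    uv_def uw_def vw_def
  have step: "s = t \<or> s = u \<and> t = a \<and> link12 \<alpha> \<or>
    s = a \<and> t = u \<and> link12 \<alpha> \<or>
    s = u \<and> t = b \<and> link13 \<alpha> \<or>
    s = b \<and> t = u \<and> link13 \<alpha> \<or>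
    s = a \<and> t = b \<and> link23 \<alpha> \<or>
    s = b \<and> t = a \<and> link23 \<alpha> \<or>
    s = a \<and> t = v \<and> link12 \<beta> \<or>
    s = v \<and> t = a \<and> link12 \<beta> \<or>
    s = a \<and> t = c \<and> link13 \<beta> \<or>
    s = c \<and> t = a \<and> link13 \<beta> \<or>
    s = v \<and> t = c \<and> link23 \<beta> \<or>
    s = c \<and> t = v \<and> link23 \<beta> \<or>
    s = b \<and> t = c \<and> link12 \<gamma> \<or>
    s = c \<and> t = b \<and> link12 \<gamma> \<or>
    s = b \<and> t = w \<and> link13 \<gamma> \<or>
    s = w \<and> t = b \<and> link13 \<gamma> \<or>
    s = c \<and> t = w \<and> link23 \<gamma> \<or>
    s = w \<and> t = c \<and> link23 \<gamma>"
    if st: "i \<in> {0, 1, 2}" "s \<in> [{u, a, b}, {a, v, c}, {b, c, w}] ! i"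
      "t \<in> [{u, a, b}, {a, v, c}, {b, c, w}] ! i" "reachable ([T1, T2, T3] ! i) s t" for i :: nat and s t
  proof -
    consider "s \<in> {u, a, b}" "t \<in> {u, a, b}" "reachable T1 s t"
      | "s \<in> {a, v, c}" "t \<in> {a, v, c}" "reachable T2 s t"
      | "s \<in> {b, c, w}" "t \<in> {b, c, w}" "reachable T3 s t"
      using st by (elim insertE emptyE) simp_all
    then show ?thesis
    proof cases
      case 1
      then show ?thesis by (elim insertE emptyE; hypsubst; simp add: r1 r2)
    next
      case 2
      then show ?thesis by (elim insertE emptyE; hypsubst; simp add: r1 r2)
    next
      case 3
      then show ?thesis by (elim insertE emptyE; hypsubst; simp add: r1 r2)
    qed
  qed
  \<comment> \<open>\<open>reachable_closed_corners\<close> with the closure spelled out: six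
    ordered pairs of corners in each of the three parts.\<close>
  have into: "y \<in> Z" if
    closed: "u \<in> Z \<and> link12 \<alpha> \<longrightarrow> a \<in> Z" "u \<in> Z \<and> link13 \<alpha> \<longrightarrow> b \<in> Z" "a \<in> Z \<and> link23 \<alpha> \<longrightarrow> b \<in> Z"
    "a \<in> Z \<and> link12 \<alpha> \<longrightarrow> u \<in> Z" "b \<in> Z \<and> link13 \<alpha> \<longrightarrow> u \<in> Z" "b \<in> Z \<and> link23 \<alpha> \<longrightarrow> a \<in> Z"
    "a \<in> Z \<and> link12 \<beta> \<longrightarrow> v \<in> Z" "a \<in> Z \<and> link13 \<beta> \<longrightarrow> c \<in> Z" "v \<in> Z \<and> link23 \<beta> \<longrightarrow> c \<in> Z"
    "v \<in> Z \<and> link12 \<beta> \<longrightarrow> a \<in> Z" "c \<in> Z \<and> link13 \<beta> \<longrightarrow> a \<in> Z" "c \<in> Z \<and> link23 \<beta> \<longrightarrow> v \<in> Z"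
    "b \<in> Z \<and> link12 \<gamma> \<longrightarrow> c \<in> Z" "b \<in> Z \<and> link13 \<gamma> \<longrightarrow> w \<in> Z" "c \<in> Z \<and> link23 \<gamma> \<longrightarrow> w \<in> Z"
    "c \<in> Z \<and> link12 \<gamma> \<longrightarrow> b \<in> Z" "w \<in> Z \<and> link13 \<gamma> \<longrightarrow> b \<in> Z" "w \<in> Z \<and> link23 \<gamma> \<longrightarrow> c \<in> Z"
    and xy: "reachable T x y" "x \<in> Z" "x \<in> {u, v, w}" "y \<in> {u, v, w, a, b, c}" for Z x y
  proof -
    have "t \<in> Z" if "i \<in> {0, 1, 2}" "s \<in> Z" "s \<in> [{u, a, b}, {a, v, c}, {b, c, w}] ! i"
      "t \<in> [{u, a, b}, {a, v, c}, {b, c, w}] ! i" "reachable ([T1, T2, T3] ! i) s t" for i :: nat and s t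
      using step[OF that(1,3,4,5)] that(2)
      by (elim disjE conjE)
        (simp_all only: simp_thms, (rule closed[THEN mp], rule conjI, assumption, assumption)+)
    moreover obtain k where "k \<in> {0, 1, 2::nat}" "x \<in> [{u, a, b}, {a, v, c}, {b, c, w}] ! k"
      using xy(3) by force
    moreover obtain l where "l \<in> {0, 1, 2::nat}" "y \<in> [{u, a, b}, {a, v, c}, {b, c, w}] ! l"
      using xy(4) by force
    ultimately show ?thesis
      using reachable_closed_corners[of Z x y k l] xy(1,2) unfolding union_parts by blast
  qed
  \<comment> \<open>The set of corners that the formulas claim to be joined to \<open>u\<close>.
    Distinctness of the corners turns membership into propositional letters, and closure then
    follows from transitivity of the links.\<close>
  have from_u: "y \<in> {y. y = u \<or> y = a \<and> ua \<or> y = b \<and> ub \<or> y = c \<and> uc \<or> y = v \<and> uv \<or> y = w \<and> uw}"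
      (is "_ \<in> ?Z") if "reachable T u y" "y \<in> {u, v, w, a, b, c}" for y
  proof -
    have mem: "u \<in> ?Z \<longleftrightarrow> True" "a \<in> ?Z \<longleftrightarrow> ua" "b \<in> ?Z \<longleftrightarrow> ub" "c \<in> ?Z \<longleftrightarrow> uc" "v \<in> ?Z \<longleftrightarrow> uv" "w \<in> ?Z \<longleftrightarrow> uw"
      using distinct_corners by auto
    show ?thesis
      by (rule into[OF _ _ _ _ _ _ _ _ _ _ _ _ _ _ _ _ _ _ that(1) mem(1)[THEN iffD2, OF TrueI] _ that(2)]; (unfold mem)?;
          (insert links; unfold defs; argo)?) simp_all
  qed
  have from_v: "y \<in> {y. y = v \<or> y = a \<and> va \<or> y = b \<and> vb \<or> y = c \<and> vc \<or> y = u \<and> uv \<or> y = w \<and> vw}"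
      (is "_ \<in> ?Z") if "reachable T v y" "y \<in> {u, v, w, a, b, c}" for y
  proof -
    have mem: "v \<in> ?Z \<longleftrightarrow> True" "a \<in> ?Z \<longleftrightarrow> va" "b \<in> ?Z \<longleftrightarrow> vb" "c \<in> ?Z \<longleftrightarrow> vc" "u \<in> ?Z \<longleftrightarrow> uv" "w \<in> ?Z \<longleftrightarrow> vw"
      using distinct_corners by auto
    show ?thesis
      by (rule into[OF _ _ _ _ _ _ _ _ _ _ _ _ _ _ _ _ _ _ that(1) mem(1)[THEN iffD2, OF TrueI] _ that(2)]; (unfold mem)?;
          (insert links; unfold defs; argo)?) simp_all
  qed
  have from_w: "y \<in> {y. y = w \<or> y = a \<and> wa \<or> y = b \<and> wb \<or> y = c \<and> wc \<or> y = u \<and> uw \<or> y = v \<and> vw}"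
      (is "_ \<in> ?Z") if "reachable T w y" "y \<in> {u, v, w, a, b, c}" for y
  proof -
    have mem: "w \<in> ?Z \<longleftrightarrow> True" "a \<in> ?Z \<longleftrightarrow> wa" "b \<in> ?Z \<longleftrightarrow> wb" "c \<in> ?Z \<longleftrightarrow> wc" "u \<in> ?Z \<longleftrightarrow> uw" "v \<in> ?Z \<longleftrightarrow> vw"
      using distinct_corners by auto
    show ?thesis
      by (rule into[OF _ _ _ _ _ _ _ _ _ _ _ _ _ _ _ _ _ _ that(1) mem(1)[THEN iffD2, OF TrueI] _ that(2)]; (unfold mem)?;
          (insert links; unfold defs; argo)?) simp_all
  qed
  have tr: "reachable T x z" if "reachable T x y" "reachable T y z" for x y z
    using that by (rule reachable_trans)
  have sy: "reachable T y x" if "reachable T x y" for x y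
    using that by (simp add: reachable_sym)
  \<comment> \<open>The other direction: a walk for every formula, composed of connections inside
    the parts.\<close>
  have base: "link12 \<alpha> \<Longrightarrow> reachable T u a" "link13 \<alpha> \<Longrightarrow> reachable T u b"
    "link23 \<alpha> \<Longrightarrow> reachable T a b" "link12 \<beta> \<Longrightarrow> reachable T a v" "link13 \<beta> \<Longrightarrow> reachable T a c"
    "link23 \<beta> \<Longrightarrow> reachable T v c" "link12 \<gamma> \<Longrightarrow> reachable T b c" "link13 \<gamma> \<Longrightarrow> reachable T b w"
    "link23 \<gamma> \<Longrightarrow> reachable T c w"
    using r1 reachable_parts by blast+
  note sbase = base[THEN sy]
  have ab: "ab \<Longrightarrow> reachable T a b"
    using base tr[OF base(5) sbase(7)] unfolding ab_def by blast
  have ac: "ac \<Longrightarrow> reachable T a c"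
    using base tr[OF base(3) base(7)] unfolding ac_def by blast
  have bc: "bc \<Longrightarrow> reachable T b c"
    using base tr[OF sbase(3) base(5)] unfolding bc_def by blast
  have ua: "ua \<Longrightarrow> reachable T u a"
    using base tr[OF base(2) ab[THEN sy]] unfolding ua_def by blast
  have ub: "ub \<Longrightarrow> reachable T u b"
    using base tr[OF base(1) ab] unfolding ub_def by blast
  have uc: "uc \<Longrightarrow> reachable T u c"
    using tr[OF base(1) ac] tr[OF base(2) bc] unfolding uc_def by blast
  have va: "va \<Longrightarrow> reachable T v a"
    using sbase tr[OF base(6) ac[THEN sy]] unfolding va_def by blast
  have vb: "vb \<Longrightarrow> reachable T v b"
    using tr[OF sbase(4) ab] tr[OF base(6) bc[THEN sy]] unfolding vb_def by blast
  have vc: "vc \<Longrightarrow> reachable T v c"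
    using base tr[OF sbase(4) ac] unfolding vc_def by blast
  have wa: "wa \<Longrightarrow> reachable T w a"
    using tr[OF sbase(8) ab[THEN sy]] tr[OF sbase(9) ac[THEN sy]] unfolding wa_def by blast
  have wb: "wb \<Longrightarrow> reachable T w b"
    using sbase tr[OF sbase(9) bc[THEN sy]] unfolding wb_def by blast
  have wc: "wc \<Longrightarrow> reachable T w c"
    using sbase tr[OF sbase(8) bc] unfolding wc_def by blast
  have uv: "uv \<Longrightarrow> reachable T u v"
    using tr[OF ua base(4)] tr[OF uc sbase(6)] unfolding uv_def by blast
  have uw: "uw \<Longrightarrow> reachable T u w"
    using tr[OF ub base(8)] tr[OF uc base(9)] unfolding uw_def by blast
  have vw: "vw \<Longrightarrow> reachable T v w"
    using tr[OF vb base(8)] tr[OF vc base(9)] unfolding vw_def by blast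
  have fu: "reachable T u a \<Longrightarrow> ua" "reachable T u b \<Longrightarrow> ub" "reachable T u c \<Longrightarrow> uc"
    "reachable T u v \<Longrightarrow> uv" "reachable T u w \<Longrightarrow> uw"
    by (drule from_u, simp, insert distinct_corners, simp, blast)+
  have fv: "reachable T v a \<Longrightarrow> va" "reachable T v b \<Longrightarrow> vb" "reachable T v c \<Longrightarrow> vc"
    "reachable T v w \<Longrightarrow> vw"
    by (drule from_v, simp, insert distinct_corners, simp, blast)+
  have fw: "reachable T w a \<Longrightarrow> wa" "reachable T w b \<Longrightarrow> wb" "reachable T w c \<Longrightarrow> wc"
    by (drule from_w, simp, insert distinct_corners, simp, blast)+
  have uvw: "reachable T u v \<longleftrightarrow> uv" "reachable T u w \<longleftrightarrow> uw" "reachable T v w \<longleftrightarrow> vw"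
    using uv uw vw fu(4,5) fv(4) by blast+
  have abc: "reachable T u a \<longleftrightarrow> ua" "reachable T u b \<longleftrightarrow> ub" "reachable T u c \<longleftrightarrow> uc"
    "reachable T v a \<longleftrightarrow> va" "reachable T v b \<longleftrightarrow> vb" "reachable T v c \<longleftrightarrow> vc"
    "reachable T w a \<longleftrightarrow> wa" "reachable T w b \<longleftrightarrow> wb" "reachable T w c \<longleftrightarrow> wc"
    by (rule iffI; erule ua ub uc va vb vc wa wb wc fu fv fw)+
  let ?att = "\<lambda>x. reachable T x u \<or> reachable T x v \<or> reachable T x w"
  have att_abc: "?att a \<longleftrightarrow> ua \<or> va \<or> wa" "?att b \<longleftrightarrow> ub \<or> vb \<or> wb" "?att c \<longleftrightarrow> uc \<or> vc \<or> wc"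
    unfolding abc[symmetric] using sy by blast+
  \<comment> \<open>Every vertex of a part reaches a corner of that part, so only the shared corners
    can fail to be attached.\<close>
  have "(\<forall>x\<in>V1 \<union> V2 \<union> V3. ?att x) \<longleftrightarrow> ?att a \<and> ?att b \<and> ?att c"
  proof
    assume att: "?att a \<and> ?att b \<and> ?att c"
    have pull: "?att x" if "reachable T x y" "?att y" for x y
      using that tr by blast
    have corners: "?att y" if "y \<in> {u, v, w, a, b, c}" for y
      using that att by (elim insertE emptyE) (simp_all only: reachable_refl simp_thms)
    have "?att x" if "x \<in> V1" for x
    proof -
      obtain y where "y \<in> {u, a, b}" "reachable T1 x y"
        using types(1) \<open>x \<in> V1\<close> unfolding has_type_def by blast
      then show ?thesis by (intro pull[OF reachable_parts(1) corners]) auto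
    qed
    moreover have "?att x" if "x \<in> V2" for x
    proof -
      obtain y where "y \<in> {a, v, c}" "reachable T2 x y"
        using types(2) \<open>x \<in> V2\<close> unfolding has_type_def by blast
      then show ?thesis by (intro pull[OF reachable_parts(2) corners]) auto
    qed
    moreover have "?att x" if "x \<in> V3" for x
    proof -
      obtain y where "y \<in> {b, c, w}" "reachable T3 x y"
        using types(3) \<open>x \<in> V3\<close> unfolding has_type_def by blast
      then show ?thesis by (intro pull[OF reachable_parts(3) corners]) auto
    qed
    ultimately show "\<forall>x\<in>V1 \<union> V2 \<union> V3. ?att x" by blast
  next
    assume "\<forall>x\<in>V1 \<union> V2 \<union> V3. ?att x"
    then show "?att a \<and> ?att b \<and> ?att c" using shared_corners by blast
  qed
  then have "has_type (V1 \<union> V2 \<union> V3) T u v w \<tau> \<longleftrightarrow>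
      (ua \<or> va \<or> wa) \<and> (ub \<or> vb \<or> wb) \<and> (uc \<or> vc \<or> wc) \<and>
      (uv \<longleftrightarrow> link12 \<tau>) \<and> (uw \<longleftrightarrow> link13 \<tau>) \<and> (vw \<longleftrightarrow> link23 \<tau>)"
    unfolding has_type_def uvw att_abc by simp
  then show ?thesis
    unfolding composes_def Let_def defs .
qed

end

end

text \<open>Four blocks in total mean two trees and one part with two blocks. That part must cut off
  a shared corner: cutting off its outer corner would separate it from the others and close a cycle
  through \<open>a\<close>, \<open>b\<close>, \<open>c\<close>. Two shared corners in each of three
  parts give six triples.\<close>

lemma glues_Joined:
  "{(\<alpha>, \<beta>, \<gamma>). glues \<alpha> \<beta> \<gamma> Joined} = {
    (Joined, Joined, Apart2), (Joined, Joined, Apart1), (Joined, Apart3, Joined),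
    (Joined, Apart1, Joined), (Apart3, Joined, Joined), (Apart2, Joined, Joined)}"
proof -
  have "glues \<alpha> \<beta> \<gamma> Joined \<longleftrightarrow> (\<alpha>, \<beta>, \<gamma>) \<in> {
    (Joined, Joined, Apart2), (Joined, Joined, Apart1), (Joined, Apart3, Joined),
    (Joined, Apart1, Joined), (Apart3, Joined, Joined), (Apart2, Joined, Joined)}" for \<alpha> \<beta> \<gamma>
    unfolding glues_def composes_def Let_def by (cases \<alpha>; cases \<beta>; cases \<gamma>; simp)
  then show ?thesis
    by (simp only: set_eq_iff split_paired_All mem_Collect_eq prod.case simp_thms)
qed

text \<open>Five blocks in total: either two trees and a \<open>Separate\<close> part, which happens
  once, or one tree and two parts with two blocks, which happens seven times.\<close>

lemma glues_Apart3:
  "{(\<alpha>, \<beta>, \<gamma>). glues \<alpha> \<beta> \<gamma> Apart3} = {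
    (Joined, Joined, Separate), (Joined, Apart3, Apart3), (Joined, Apart3, Apart1),
    (Joined, Apart1, Apart3), (Apart3, Joined, Apart3), (Apart3, Joined, Apart2),
    (Apart3, Apart3, Joined), (Apart2, Joined, Apart3)}"
proof -
  have "glues \<alpha> \<beta> \<gamma> Apart3 \<longleftrightarrow> (\<alpha>, \<beta>, \<gamma>) \<in> {
    (Joined, Joined, Separate), (Joined, Apart3, Apart3), (Joined, Apart3, Apart1),
    (Joined, Apart1, Apart3), (Apart3, Joined, Apart3), (Apart3, Joined, Apart2),
    (Apart3, Apart3, Joined), (Apart2, Joined, Apart3)}" for \<alpha> \<beta> \<gamma>
    unfolding glues_def composes_def Let_def by (cases \<alpha>; cases \<beta>; cases \<gamma>; simp)
  then show ?thesis
    by (simp only: set_eq_iff split_paired_All mem_Collect_eq prod.case simp_thms)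
qed

text \<open>Mirror image of the table for \<open>Apart3\<close>: exchange the second and third part
  and apply \<open>swap23\<close> to every type.\<close>

lemma glues_Apart2:
  "{(\<alpha>, \<beta>, \<gamma>). glues \<alpha> \<beta> \<gamma> Apart2} = {
    (Joined, Apart2, Apart2), (Joined, Apart2, Apart1), (Joined, Apart1, Apart2),
    (Joined, Separate, Joined), (Apart3, Apart2, Joined), (Apart2, Joined, Apart2),
    (Apart2, Apart3, Joined), (Apart2, Apart2, Joined)}"
proof -
  have "glues \<alpha> \<beta> \<gamma> Apart2 \<longleftrightarrow> (\<alpha>, \<beta>, \<gamma>) \<in> {
    (Joined, Apart2, Apart2), (Joined, Apart2, Apart1), (Joined, Apart1, Apart2),
    (Joined, Separate, Joined), (Apart3, Apart2, Joined), (Apart2, Joined, Apart2),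
    (Apart2, Apart3, Joined), (Apart2, Apart2, Joined)}" for \<alpha> \<beta> \<gamma>
    unfolding glues_def composes_def Let_def by (cases \<alpha>; cases \<beta>; cases \<gamma>; simp)
  then show ?thesis
    by (simp only: set_eq_iff split_paired_All mem_Collect_eq prod.case simp_thms)
qed

text \<open>Six blocks in total: 1 + 2 + 3 in some order for twelve triples, 2 + 2 + 2 for
  fourteen.\<close>

lemma glues_Separate:
  "{(\<alpha>, \<beta>, \<gamma>). glues \<alpha> \<beta> \<gamma> Separate} = {
    (Joined, Apart2, Separate), (Joined, Apart1, Separate), (Joined, Separate, Apart3),
    (Joined, Separate, Apart1), (Apart3, Apart2, Apart3), (Apart3, Apart2, Apart2),
    (Apart3, Apart1, Apart3), (Apart3, Apart1, Apart2), (Apart3, Separate, Joined),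
    (Apart2, Joined, Separate), (Apart2, Apart3, Apart3), (Apart2, Apart3, Apart1),
    (Apart2, Apart2, Apart3), (Apart2, Apart2, Apart1), (Apart1, Joined, Separate),
    (Apart1, Apart3, Apart3), (Apart1, Apart3, Apart1), (Apart1, Apart2, Apart2),
    (Apart1, Apart2, Apart1), (Apart1, Apart1, Apart3), (Apart1, Apart1, Apart2),
    (Apart1, Separate, Joined), (Separate, Joined, Apart3), (Separate, Joined, Apart2),
    (Separate, Apart3, Joined), (Separate, Apart2, Joined)}"
proof -
  have "glues \<alpha> \<beta> \<gamma> Separate \<longleftrightarrow> (\<alpha>, \<beta>, \<gamma>) \<in> {
    (Joined, Apart2, Separate), (Joined, Apart1, Separate), (Joined, Separate, Apart3),
    (Joined, Separate, Apart1), (Apart3, Apart2, Apart3), (Apart3, Apart2, Apart2),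
    (Apart3, Apart1, Apart3), (Apart3, Apart1, Apart2), (Apart3, Separate, Joined),
    (Apart2, Joined, Separate), (Apart2, Apart3, Apart3), (Apart2, Apart3, Apart1),
    (Apart2, Apart2, Apart3), (Apart2, Apart2, Apart1), (Apart1, Joined, Separate),
    (Apart1, Apart3, Apart3), (Apart1, Apart3, Apart1), (Apart1, Apart2, Apart2),
    (Apart1, Apart2, Apart1), (Apart1, Apart1, Apart3), (Apart1, Apart1, Apart2),
    (Apart1, Separate, Joined), (Separate, Joined, Apart3), (Separate, Joined, Apart2),
    (Separate, Apart3, Joined), (Separate, Apart2, Joined)}" for \<alpha> \<beta> \<gamma>
    unfolding glues_def composes_def Let_def by (cases \<alpha>; cases \<beta>; cases \<gamma>; simp)
  then show ?thesis
    by (simp only: set_eq_iff split_paired_All mem_Collect_eq prod.case simp_thms)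
qed

section \<open>Counting forests of a union through its three parts\<close>

definition deg_count ::
  "'a set \<Rightarrow> 'a set set \<Rightarrow> 'a \<Rightarrow> 'a \<Rightarrow> 'a \<Rightarrow> corner_type \<Rightarrow> nat \<Rightarrow> 'a \<Rightarrow> nat" where
  "deg_count V E p q r \<tau> j x = card {T \<in> corner_forests V E p q r \<tau>. edges_at T x = j}"

context triangle_gluing
begin

text \<open>Given the edge equations of the parts, adding them and using
  \<open>card_vertices\<close> yields that of the whole exactly when the block numbers obey
  \<open>glues\<close>; connectivity is \<open>has_type_glue\<close>.\<close>

lemma corner_forests_glue_iff:
  "T \<in> corner_forests (V1 \<union> V2 \<union> V3) (E1 \<union> E2 \<union> E3) u v w \<tau> \<longleftrightarrow>
     T \<subseteq> E1 \<union> E2 \<union> E3 \<and> (\<exists>\<alpha> \<beta> \<gamma>. glues \<alpha> \<beta> \<gamma> \<tau> \<and>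
       T \<inter> E1 \<in> corner_forests V1 E1 u a b \<alpha> \<and> T \<inter> E2 \<in> corner_forests V2 E2 a v c \<beta> \<and>
       T \<inter> E3 \<in> corner_forests V3 E3 b c w \<gamma>)"
    (is "?l \<longleftrightarrow> ?sub \<and> ?r")
proof (cases ?sub)
  case sub: True
  let ?T1 = "T \<inter> E1" and ?T2 = "T \<inter> E2" and ?T3 = "T \<inter> E3"
  have parts: "?T1 \<subseteq> E1" "?T2 \<subseteq> E2" "?T3 \<subseteq> E3" "T = ?T1 \<union> ?T2 \<union> ?T3"
    using sub by auto
  have "card T = card (?T1 \<union> ?T2 \<union> ?T3)" using parts(4) by simp
  also have "\<dots> = card ?T1 + card ?T2 + card ?T3"
    using edges_disjoint graphs is_graph_finite(2) by (subst card_Un_disjoint; auto)+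
  finally have card_T: "card T = card ?T1 + card ?T2 + card ?T3" .
  note glue = has_type_glue[OF parts]
  show ?thesis
  proof
    assume ?l
    then have T: "has_type (V1 \<union> V2 \<union> V3) T u v w \<tau>" "card (V1 \<union> V2 \<union> V3) = blocks \<tau> + card T"
      by (auto simp: corner_forests_def)
    obtain \<alpha> where \<alpha>: "has_type V1 ?T1 u a b \<alpha>"
      using has_type_exists attached_parts(1)[OF parts T(1)] by metis
    obtain \<beta> where \<beta>: "has_type V2 ?T2 a v c \<beta>"
      using has_type_exists attached_parts(2)[OF parts T(1)] by metis
    obtain \<gamma> where \<gamma>: "has_type V3 ?T3 b c w \<gamma>"
      using has_type_exists attached_parts(3)[OF parts T(1)] by metis
    have comp: "composes \<alpha> \<beta> \<gamma> \<tau>"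
      using glue[OF \<alpha> \<beta> \<gamma>] T(1) by simp
    have "card V1 \<le> blocks \<alpha> + card ?T1" "card V2 \<le> blocks \<beta> + card ?T2" "card V3 \<le> blocks \<gamma> + card ?T3"
      using has_type_card_le[OF is_graph_subset[OF graphs(1) parts(1)] \<alpha>]
        has_type_card_le[OF is_graph_subset[OF graphs(2) parts(2)] \<beta>]
        has_type_card_le[OF is_graph_subset[OF graphs(3) parts(3)] \<gamma>] corners shared_corners by blast+
    \<comment> \<open>Each part has at least as many edges as a forest, and the total leaves no slack.\<close>
    with composes_blocks[OF comp] T(2) card_T card_vertices
    have "card V1 = blocks \<alpha> + card ?T1" "card V2 = blocks \<beta> + card ?T2" "card V3 = blocks \<gamma> + card ?T3"
      "blocks \<alpha> + blocks \<beta> + blocks \<gamma> = 3 + blocks \<tau>" by linarith+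
    with \<alpha> \<beta> \<gamma> comp have "glues \<alpha> \<beta> \<gamma> \<tau>" "?T1 \<in> corner_forests V1 E1 u a b \<alpha>"
      "?T2 \<in> corner_forests V2 E2 a v c \<beta>" "?T3 \<in> corner_forests V3 E3 b c w \<gamma>"
      by (simp_all add: glues_def corner_forests_def)
    with sub show "?sub \<and> ?r" by blast
  next
    assume "?sub \<and> ?r"
    then obtain \<alpha> \<beta> \<gamma> where g: "glues \<alpha> \<beta> \<gamma> \<tau>" and T: "?T1 \<in> corner_forests V1 E1 u a b \<alpha>"
      "?T2 \<in> corner_forests V2 E2 a v c \<beta>" "?T3 \<in> corner_forests V3 E3 b c w \<gamma>" by blast
    have types: "has_type V1 ?T1 u a b \<alpha>" "has_type V2 ?T2 a v c \<beta>" "has_type V3 ?T3 b c w \<gamma>"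
      and cards: "card V1 = blocks \<alpha> + card ?T1" "card V2 = blocks \<beta> + card ?T2"
        "card V3 = blocks \<gamma> + card ?T3"
      using T by (simp_all add: corner_forests_def)
    have "has_type (V1 \<union> V2 \<union> V3) T u v w \<tau>"
      using glue[OF types] g by (simp add: glues_def)
    moreover have "card (V1 \<union> V2 \<union> V3) = blocks \<tau> + card T"
      using cards card_T card_vertices g by (simp add: glues_def)
    ultimately show ?l using sub by (simp add: corner_forests_def)
  qed
qed (auto simp: corner_forests_def)

text \<open>Cutting along the three disjoint edge sets is a bijection. The predicates let it serve
  total counts and degree counts alike.\<close>

lemma card_corner_forests_glue:
  "card {T \<in> corner_forests (V1 \<union> V2 \<union> V3) (E1 \<union> E2 \<union> E3) u v w \<tau>.
      P1 (T \<inter> E1) \<and> P2 (T \<inter> E2) \<and> P3 (T \<inter> E3)} =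
   (\<Sum>(\<alpha>, \<beta>, \<gamma>)\<in>{(\<alpha>, \<beta>, \<gamma>). glues \<alpha> \<beta> \<gamma> \<tau>}.
      card {T \<in> corner_forests V1 E1 u a b \<alpha>. P1 T} *
      card {T \<in> corner_forests V2 E2 a v c \<beta>. P2 T} *
      card {T \<in> corner_forests V3 E3 b c w \<gamma>. P3 T})"
    (is "card ?L = (\<Sum>(\<alpha>, \<beta>, \<gamma>)\<in>?G. card (?A \<alpha>) * card (?B \<beta>) * card (?C \<gamma>))")
proof -
  let ?S = "\<lambda>(\<alpha>, \<beta>, \<gamma>). ?A \<alpha> \<times> ?B \<beta> \<times> ?C \<gamma>"
  let ?cut = "\<lambda>T. (T \<inter> E1, T \<inter> E2, T \<inter> E3)"
  have fin: "finite (?A \<alpha>)" "finite (?B \<beta>)" "finite (?C \<gamma>)" for \<alpha> \<beta> \<gamma>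
    using graphs[THEN is_graph_finite(2), THEN finite_corner_forests] by simp_all
  have "bij_betw ?cut ?L (\<Union>(?S ` ?G))"
    unfolding bij_betw_def
  proof
    show "inj_on ?cut ?L"
    proof (rule inj_onI)
      fix T T'
      assume "T \<in> ?L" "T' \<in> ?L" "?cut T = ?cut T'"
      moreover from this have "T \<subseteq> E1 \<union> E2 \<union> E3" "T' \<subseteq> E1 \<union> E2 \<union> E3"
        by (simp_all add: corner_forests_glue_iff)
      ultimately show "T = T'" by blast
    qed
    have "?cut T \<in> \<Union>(?S ` ?G)" if "T \<in> ?L" for T
    proof -
      obtain \<alpha> \<beta> \<gamma> where "glues \<alpha> \<beta> \<gamma> \<tau>" "T \<inter> E1 \<in> ?A \<alpha>" "T \<inter> E2 \<in> ?B \<beta>" "T \<inter> E3 \<in> ?C \<gamma>"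
        using \<open>T \<in> ?L\<close> unfolding corner_forests_glue_iff by blast
      then show ?thesis by (intro UN_I[of "(\<alpha>, \<beta>, \<gamma>)"]) auto
    qed
    moreover have "z \<in> ?cut ` ?L" if z: "z \<in> \<Union>(?S ` ?G)" for z
    proof -
      obtain \<alpha> \<beta> \<gamma> T1 T2 T3 where "glues \<alpha> \<beta> \<gamma> \<tau>" and zT: "z = (T1, T2, T3)"
        and T: "T1 \<in> ?A \<alpha>" "T2 \<in> ?B \<beta>" "T3 \<in> ?C \<gamma>"
        using z by auto
      have "T1 \<subseteq> E1" "T2 \<subseteq> E2" "T3 \<subseteq> E3" using T by (auto simp: corner_forests_def)
      then have cut: "?cut (T1 \<union> T2 \<union> T3) = (T1, T2, T3)" and sub: "T1 \<union> T2 \<union> T3 \<subseteq> E1 \<union> E2 \<union> E3"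
        using edges_disjoint by auto
      have "T1 \<union> T2 \<union> T3 \<in> ?L"
        unfolding mem_Collect_eq corner_forests_glue_iff
        using cut sub T \<open>glues \<alpha> \<beta> \<gamma> \<tau>\<close> by auto
      then show ?thesis using cut zT by (metis (no_types, lifting) imageI)
    qed
    ultimately show "?cut ` ?L = \<Union>(?S ` ?G)" by blast
  qed
  then have "card ?L = card (\<Union>(?S ` ?G))" by (rule bij_betw_same_card)
  also have "\<dots> = (\<Sum>g\<in>?G. card (?S g))"
  proof (rule card_UN_disjoint)
    show "finite ?G" by simp
    show "\<forall>g\<in>?G. finite (?S g)" using fin by auto
    \<comment> \<open>The type of a part is unique, so different triples of types have no forests in
      common.\<close>
    have "g = g'" if "z \<in> ?S g" "z \<in> ?S g'" for z g g'
      using that by (auto simp: corner_forests_def dest: has_type_unique)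
    then show "\<forall>g\<in>?G. \<forall>g'\<in>?G. g \<noteq> g' \<longrightarrow> ?S g \<inter> ?S g' = {}" by blast
  qed
  also have "\<dots> = (\<Sum>(\<alpha>, \<beta>, \<gamma>)\<in>?G. card (?A \<alpha>) * card (?B \<beta>) * card (?C \<gamma>))"
    by (rule sum.cong) (auto simp: card_cartesian_product mult.assoc)
  finally show ?thesis .
qed

lemma card_corner_forests_total:
  "card (corner_forests (V1 \<union> V2 \<union> V3) (E1 \<union> E2 \<union> E3) u v w \<tau>) =
   (\<Sum>(\<alpha>, \<beta>, \<gamma>)\<in>{(\<alpha>, \<beta>, \<gamma>). glues \<alpha> \<beta> \<gamma> \<tau>}. card (corner_forests V1 E1 u a b \<alpha>) *
      card (corner_forests V2 E2 a v c \<beta>) * card (corner_forests V3 E3 b c w \<gamma>))"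
  using card_corner_forests_glue[of \<tau> "\<lambda>_. True" "\<lambda>_. True" "\<lambda>_. True"] by simp

text \<open>A vertex that is not shared has all its edges in its own part, so its degree constrains
  that part alone.\<close>

lemma deg_count_first:
  assumes "x \<in> V1" "x \<noteq> a" "x \<noteq> b"
  shows "deg_count (V1 \<union> V2 \<union> V3) (E1 \<union> E2 \<union> E3) u v w \<tau> j x =
   (\<Sum>(\<alpha>, \<beta>, \<gamma>)\<in>{(\<alpha>, \<beta>, \<gamma>). glues \<alpha> \<beta> \<gamma> \<tau>}. deg_count V1 E1 u a b \<alpha> j x *
      card (corner_forests V2 E2 a v c \<beta>) * card (corner_forests V3 E3 b c w \<gamma>))"
proof -
  have "x \<notin> V2" "x \<notin> V3" using assms meet by blast+
  then have "{e \<in> T. x \<in> e} = {e \<in> T \<inter> E1. x \<in> e}" if "T \<subseteq> E1 \<union> E2 \<union> E3" for T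
    using that graphs(2,3) by (auto simp: is_graph_def)
  then have "{T \<in> corner_forests (V1 \<union> V2 \<union> V3) (E1 \<union> E2 \<union> E3) u v w \<tau>. edges_at T x = j} =
    {T \<in> corner_forests (V1 \<union> V2 \<union> V3) (E1 \<union> E2 \<union> E3) u v w \<tau>. edges_at (T \<inter> E1) x = j}"
    by (auto simp: edges_at_def corner_forests_def)
  then show ?thesis
    using card_corner_forests_glue[of \<tau> "\<lambda>T. edges_at T x = j" "\<lambda>_. True" "\<lambda>_. True"]
    by (simp add: deg_count_def)
qed

lemma deg_count_second:
  assumes "x \<in> V2" "x \<noteq> a" "x \<noteq> c"
  shows "deg_count (V1 \<union> V2 \<union> V3) (E1 \<union> E2 \<union> E3) u v w \<tau> j x =
   (\<Sum>(\<alpha>, \<beta>, \<gamma>)\<in>{(\<alpha>, \<beta>, \<gamma>). glues \<alpha> \<beta> \<gamma> \<tau>}. card (corner_forests V1 E1 u a b \<alpha>) *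
      deg_count V2 E2 a v c \<beta> j x * card (corner_forests V3 E3 b c w \<gamma>))"
proof -
  have "x \<notin> V1" "x \<notin> V3" using assms meet by blast+
  then have "{e \<in> T. x \<in> e} = {e \<in> T \<inter> E2. x \<in> e}" if "T \<subseteq> E1 \<union> E2 \<union> E3" for T
    using that graphs(1,3) by (auto simp: is_graph_def)
  then have "{T \<in> corner_forests (V1 \<union> V2 \<union> V3) (E1 \<union> E2 \<union> E3) u v w \<tau>. edges_at T x = j} =
    {T \<in> corner_forests (V1 \<union> V2 \<union> V3) (E1 \<union> E2 \<union> E3) u v w \<tau>. edges_at (T \<inter> E2) x = j}"
    by (auto simp: edges_at_def corner_forests_def)
  then show ?thesis
    using card_corner_forests_glue[of \<tau> "\<lambda>_. True" "\<lambda>T. edges_at T x = j" "\<lambda>_. True"]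
    by (simp add: deg_count_def)
qed

end

subsection \<open>Isomorphisms\<close>

lemma reachable_image: "reachable T x y \<Longrightarrow> reachable ((`) \<phi> ` T) (\<phi> x) (\<phi> y)"
proof (induction rule: reachable_induct)
  case (step y z)
  then have "\<phi> ` {y, z} \<in> (`) \<phi> ` T" by (rule_tac imageI)
  then have "reachable ((`) \<phi> ` T) (\<phi> y) (\<phi> z)" by (intro reachable_edge) simp
  with step.IH show ?case by (rule reachable_trans)
qed simp

lemma image_inv_into_edges:
  assumes "inj_on \<phi> V" "is_graph V T"
  shows "(`) (inv_into V \<phi>) ` (`) \<phi> ` T = T"
proof -
  have "inv_into V \<phi> ` \<phi> ` e = e" if "e \<in> T" for e
    using assms that by (intro inv_into_image_cancel) (auto simp: is_graph_def)
  then show ?thesis by (simp add: image_image)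
qed

text \<open>The converse is \<open>reachable_image\<close> for the inverse map. Injectivity is asked
  for on \<open>V\<close> only, because \<open>refl_a n\<close> subtracts natural numbers and
  identifies points outside the gasket.\<close>

lemma reachable_image_iff:
  assumes "inj_on \<phi> V" "is_graph V T" "x \<in> V" "y \<in> V"
  shows "reachable ((`) \<phi> ` T) (\<phi> x) (\<phi> y) \<longleftrightarrow> reachable T x y"
proof
  assume "reachable ((`) \<phi> ` T) (\<phi> x) (\<phi> y)"
  from reachable_image[OF this, of "inv_into V \<phi>"] show "reachable T x y"
    using assms by (simp add: image_inv_into_edges)
qed (rule reachable_image)

lemma is_graph_image:
  assumes "inj_on \<phi> V" "is_graph V E"
  shows "is_graph (\<phi> ` V) ((`) \<phi> ` E)"
  using assms unfolding is_graph_def inj_on_def by fastforce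

lemma is_graph_Un: "is_graph V E \<Longrightarrow> is_graph V' E' \<Longrightarrow> is_graph (V \<union> V') (E \<union> E')"
  unfolding is_graph_def by (intro conjI ballI; elim conjE UnE) (auto dest!: bspec)

lemma inj_on_image_edges:
  assumes "inj_on \<phi> V" "is_graph V E"
  shows "inj_on ((`) \<phi>) E"
proof (rule inj_on_subset)
  show "inj_on ((`) \<phi>) (Pow V)" using assms(1) by (rule inj_on_image_Pow)
  show "E \<subseteq> Pow V" using assms(2) by (auto simp: is_graph_def)
qed

lemma has_type_image_iff:
  assumes "inj_on \<phi> V" "is_graph V T" "p \<in> V" "q \<in> V" "r \<in> V"
  shows "has_type (\<phi> ` V) ((`) \<phi> ` T) (\<phi> p) (\<phi> q) (\<phi> r) \<tau> \<longleftrightarrow> has_type V T p q r \<tau>"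
  using assms by (simp add: has_type_def reachable_image_iff[OF assms(1,2)] cong: ball_cong)

lemma corner_forests_image:
  assumes inj: "inj_on \<phi> V" and graph: "is_graph V E" and pqr: "p \<in> V" "q \<in> V" "r \<in> V"
  shows "corner_forests (\<phi> ` V) ((`) \<phi> ` E) (\<phi> p) (\<phi> q) (\<phi> r) \<tau> =
    (`) ((`) \<phi>) ` corner_forests V E p q r \<tau>"
proof -
  have iff: "(`) \<phi> ` T \<in> corner_forests (\<phi> ` V) ((`) \<phi> ` E) (\<phi> p) (\<phi> q) (\<phi> r) \<tau> \<longleftrightarrow>
      T \<in> corner_forests V E p q r \<tau>" if "T \<subseteq> E" for T
  proof -
    have T: "is_graph V T" using graph that by (rule is_graph_subset)
    then show ?thesis
      using that card_image[OF inj] card_image[OF inj_on_image_edges[OF inj T]]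
      by (auto simp: corner_forests_def has_type_image_iff[OF inj T pqr])
  qed
  have "S \<in> (`) ((`) \<phi>) ` corner_forests V E p q r \<tau>"
    if S: "S \<in> corner_forests (\<phi> ` V) ((`) \<phi> ` E) (\<phi> p) (\<phi> q) (\<phi> r) \<tau>" for S
  proof -
    have "S \<subseteq> (`) \<phi> ` E" using S by (simp add: corner_forests_def)
    then obtain T where "T \<subseteq> E" "S = (`) \<phi> ` T" by (meson subset_imageE)
    with S iff show ?thesis by blast
  qed
  moreover have "(`) \<phi> ` T \<in> corner_forests (\<phi> ` V) ((`) \<phi> ` E) (\<phi> p) (\<phi> q) (\<phi> r) \<tau>"
    if "T \<in> corner_forests V E p q r \<tau>" for T
  proof -
    have "T \<subseteq> E" using that by (simp add: corner_forests_def)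
    with that iff show ?thesis by blast
  qed
  ultimately show ?thesis by blast
qed

lemma edges_at_image:
  assumes "inj_on \<phi> V" "is_graph V T" "x \<in> V"
  shows "edges_at ((`) \<phi> ` T) (\<phi> x) = edges_at T x"
proof -
  have "\<phi> x \<in> \<phi> ` e \<longleftrightarrow> x \<in> e" if "e \<in> T" for e
    using that assms by (intro inj_on_image_mem_iff[OF assms(1)]) (auto simp: is_graph_def)
  then have "{e \<in> (`) \<phi> ` T. \<phi> x \<in> e} = (`) \<phi> ` {e \<in> T. x \<in> e}" by auto
  moreover have "inj_on ((`) \<phi>) {e \<in> T. x \<in> e}"
    using inj_on_image_edges[OF assms(1,2)] by (rule inj_on_subset) auto
  ultimately show ?thesis by (simp add: edges_at_def card_image)
qed

lemma inj_on_image_corner_forests: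
  assumes "inj_on \<phi> V" "is_graph V E"
  shows "inj_on ((`) ((`) \<phi>)) (corner_forests V E p q r \<tau>)"
proof (rule inj_on_subset)
  show "inj_on ((`) ((`) \<phi>)) (Pow E)"
    using inj_on_image_edges[OF assms] by (rule inj_on_image_Pow)
qed (auto simp: corner_forests_def)

lemma card_corner_forests_image:
  assumes "inj_on \<phi> V" "is_graph V E" "p \<in> V" "q \<in> V" "r \<in> V"
  shows "card (corner_forests (\<phi> ` V) ((`) \<phi> ` E) (\<phi> p) (\<phi> q) (\<phi> r) \<tau>) =
    card (corner_forests V E p q r \<tau>)"
  unfolding corner_forests_image[OF assms]
  by (rule card_image[OF inj_on_image_corner_forests[OF assms(1,2)]])

lemma deg_count_image:
  assumes "inj_on \<phi> V" "is_graph V E" "p \<in> V" "q \<in> V" "r \<in> V" "x \<in> V"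
  shows "deg_count (\<phi> ` V) ((`) \<phi> ` E) (\<phi> p) (\<phi> q) (\<phi> r) \<tau> j (\<phi> x) = deg_count V E p q r \<tau> j x"
proof -
  have "edges_at ((`) \<phi> ` T) (\<phi> x) = edges_at T x" if "T \<in> corner_forests V E p q r \<tau>" for T
  proof -
    have "is_graph V T" using that assms(2) is_graph_subset by (auto simp: corner_forests_def)
    then show ?thesis using assms(1,6) by (intro edges_at_image)
  qed
  then have "{T \<in> (`) ((`) \<phi>) ` corner_forests V E p q r \<tau>. edges_at T (\<phi> x) = j} =
    (`) ((`) \<phi>) ` {T \<in> corner_forests V E p q r \<tau>. edges_at T x = j}" by auto
  moreover have "inj_on ((`) ((`) \<phi>)) {T \<in> corner_forests V E p q r \<tau>. edges_at T x = j}"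
    using inj_on_image_corner_forests[OF assms(1,2)] by (rule inj_on_subset) auto
  ultimately show ?thesis
    unfolding deg_count_def corner_forests_image[OF assms(1-5)] by (simp add: card_image)
qed

fun swap23 :: "corner_type \<Rightarrow> corner_type" where
  "swap23 Apart3 = Apart2" | "swap23 Apart2 = Apart3" | "swap23 \<tau> = \<tau>"

fun swap13 :: "corner_type \<Rightarrow> corner_type" where
  "swap13 Apart3 = Apart1" | "swap13 Apart1 = Apart3" | "swap13 \<tau> = \<tau>"

lemma blocks_swap [simp]: "blocks (swap23 \<tau>) = blocks \<tau>" "blocks (swap13 \<tau>) = blocks \<tau>"
  by (cases \<tau>; simp)+

lemma has_type_swap23: "has_type V T p r q \<tau> \<longleftrightarrow> has_type V T p q r (swap23 \<tau>)"
  unfolding has_type_def reachable_sym[of T r q] by (cases \<tau>) auto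

lemma has_type_swap13: "has_type V T r q p \<tau> \<longleftrightarrow> has_type V T p q r (swap13 \<tau>)"
  unfolding has_type_def reachable_sym[of T r q] reachable_sym[of T r p] reachable_sym[of T q p]
  by (cases \<tau>) auto

lemma corner_forests_swap:
  "corner_forests V E p r q \<tau> = corner_forests V E p q r (swap23 \<tau>)"
  "corner_forests V E r q p \<tau> = corner_forests V E p q r (swap13 \<tau>)"
  by (simp_all add: corner_forests_def has_type_swap23[of V _ p r] has_type_swap13[of V _ r])

subsection \<open>The gasket\<close>

lemma inj_translate: "inj_on (translate d) A"
  by (auto simp: inj_on_def translate_def prod_eq_iff)

lemma sg_graph: "is_graph (sg_verts n) (sg_edges n)"
proof (induction n)
  case 0
  show ?case by (auto simp: is_graph_def sg_o_def sg_a_def sg_b_def)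
next
  case (Suc n)
  from is_graph_image[OF inj_translate this] have
    "is_graph (translate d ` sg_verts n) ((`) (translate d) ` sg_edges n)" for d .
  with Suc show ?case by (simp add: is_graph_Un)
qed

lemma image_refl_o: "refl_o ` sg_verts n = sg_verts n" "(`) refl_o ` sg_edges n = sg_edges n"
proof -
  have refl_tr: "refl_o (translate (sg_a n) p) = translate (sg_b n) (refl_o p)"
    "refl_o (translate (sg_b n) p) = translate (sg_a n) (refl_o p)" for n p
    by (simp_all add: refl_o_def translate_def sg_a_def sg_b_def)
  show "refl_o ` sg_verts n = sg_verts n"
  proof (induction n)
    case (Suc n)
    have "refl_o ` translate (sg_a n) ` sg_verts n = translate (sg_b n) ` refl_o ` sg_verts n"
      "refl_o ` translate (sg_b n) ` sg_verts n = translate (sg_a n) ` refl_o ` sg_verts n"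
      by (simp_all add: image_image refl_tr)
    with Suc show ?case by (simp add: image_Un Un_ac)
  qed (simp add: refl_o_simps insert_commute)
  show "(`) refl_o ` sg_edges n = sg_edges n"
  proof (induction n)
    case (Suc n)
    have "(`) refl_o ` (`) (translate (sg_a n)) ` sg_edges n =
        (`) (translate (sg_b n)) ` (`) refl_o ` sg_edges n"
      "(`) refl_o ` (`) (translate (sg_b n)) ` sg_edges n =
        (`) (translate (sg_a n)) ` (`) refl_o ` sg_edges n"
      by (simp_all add: image_image refl_tr)
    with Suc show ?case by (simp add: image_Un Un_ac)
  qed (simp add: refl_o_simps insert_commute)
qed

text \<open>The reflection of stage \<open>Suc n\<close> exchanges the lower-left and top copies and
  preserves the lower-right one, acting on each as \<open>refl_a n\<close> up to translation.
  \<open>sg_verts_bound\<close> makes the subtractions exact.\<close>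

lemma image_refl_a: "refl_a n ` sg_verts n = sg_verts n" "(`) (refl_a n) ` sg_edges n = sg_edges n"
proof -
  have refl_tr: "refl_a (Suc n) p = translate (sg_b n) (refl_a n p)"
    "refl_a (Suc n) (translate (sg_a n) p) = translate (sg_a n) (refl_a n p)"
    "refl_a (Suc n) (translate (sg_b n) p) = refl_a n p" if "p \<in> sg_verts n" for n p
    using sg_verts_bound[OF that] by (simp_all add: refl_a_def translate_def sg_a_def sg_b_def)
  show "refl_a n ` sg_verts n = sg_verts n"
  proof (induction n)
    case 0
    show ?case using refl_a_simps(1-3)[of 0] by (simp add: insert_commute)
  next
    case (Suc n)
    have "refl_a (Suc n) ` sg_verts n = translate (sg_b n) ` refl_a n ` sg_verts n"
      "refl_a (Suc n) ` translate (sg_a n) ` sg_verts n = translate (sg_a n) ` refl_a n ` sg_verts n"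
      "refl_a (Suc n) ` translate (sg_b n) ` sg_verts n = refl_a n ` sg_verts n"
      by (simp_all add: image_image refl_tr cong: image_cong)
    with Suc show ?case by (simp add: image_Un Un_ac)
  qed
  show "(`) (refl_a n) ` sg_edges n = sg_edges n"
  proof (induction n)
    case 0
    show ?case using refl_a_simps(1-3)[of 0] by (simp add: insert_commute)
  next
    case (Suc n)
    have edge: "refl_a (Suc n) ` e = translate (sg_b n) ` refl_a n ` e"
      "refl_a (Suc n) ` translate (sg_a n) ` e = translate (sg_a n) ` refl_a n ` e"
      "refl_a (Suc n) ` translate (sg_b n) ` e = refl_a n ` e" if "e \<in> sg_edges n" for e
    proof -
      have "e \<subseteq> sg_verts n" using that sg_graph[of n] by (auto simp: is_graph_def)
      then show "refl_a (Suc n) ` e = translate (sg_b n) ` refl_a n ` e"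
        "refl_a (Suc n) ` translate (sg_a n) ` e = translate (sg_a n) ` refl_a n ` e"
        "refl_a (Suc n) ` translate (sg_b n) ` e = refl_a n ` e"
        unfolding image_image by (auto simp: refl_tr intro!: image_cong)
    qed
    have "(`) (refl_a (Suc n)) ` sg_edges n = (`) (translate (sg_b n)) ` (`) (refl_a n) ` sg_edges n"
      "(`) (refl_a (Suc n)) ` (`) (translate (sg_a n)) ` sg_edges n =
        (`) (translate (sg_a n)) ` (`) (refl_a n) ` sg_edges n"
      "(`) (refl_a (Suc n)) ` (`) (translate (sg_b n)) ` sg_edges n = (`) (refl_a n) ` sg_edges n"
      unfolding image_image[of _ "(`) _"] by (simp_all add: edge cong: image_cong)
    with Suc show ?case by (simp add: image_Un Un_ac)
  qed
qed

lemma inj_refl_o: "inj_on refl_o A"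
  by (auto simp: inj_on_def refl_o_def prod_eq_iff)

lemma inj_refl_a: "inj_on (refl_a n) (sg_verts n)"
proof (rule inj_onI)
  fix p q
  assume "p \<in> sg_verts n" "q \<in> sg_verts n" "refl_a n p = refl_a n q"
  with sg_verts_bound[of p n] sg_verts_bound[of q n] show "p = q"
    by (auto simp: refl_a_def prod_eq_iff)
qed

definition sg_forests :: "nat \<Rightarrow> corner_type \<Rightarrow> vertex set set set" where
  "sg_forests n \<tau> = corner_forests (sg_verts n) (sg_edges n) sg_o (sg_a n) (sg_b n) \<tau>"

definition sg_deg :: "nat \<Rightarrow> corner_type \<Rightarrow> nat \<Rightarrow> vertex \<Rightarrow> nat" where
  "sg_deg n \<tau> j x = deg_count (sg_verts n) (sg_edges n) sg_o (sg_a n) (sg_b n) \<tau> j x"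

lemma card_sg_forests_swap:
  "card (sg_forests n (swap23 \<tau>)) = card (sg_forests n \<tau>)"
  "card (sg_forests n (swap13 \<tau>)) = card (sg_forests n \<tau>)"
  using card_corner_forests_image[OF inj_refl_o sg_graph, of sg_o n "sg_a n" "sg_b n" \<tau>]
    card_corner_forests_image[OF inj_refl_a sg_graph, of sg_o n "sg_a n" "sg_b n" \<tau>]
    sg_outmost[of n]
  by (simp_all add: sg_forests_def image_refl_o image_refl_a refl_o_simps refl_a_simps
      corner_forests_swap(1)[of _ _ _ "sg_b n"] corner_forests_swap(2)[of _ _ "sg_b n"])

text \<open>A reflection permutes the corners, and naming them in the old order swaps the types.
  Thus \<open>G_prob\<close> at a reflected vertex belongs to another \<open>Apart\<close> type at
  the vertex itself.\<close>

lemma sg_deg_swap: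
  assumes "x \<in> sg_verts n"
  shows "sg_deg n (swap23 \<tau>) j (refl_o x) = sg_deg n \<tau> j x"
    and "sg_deg n (swap13 \<tau>) j (refl_a n x) = sg_deg n \<tau> j x"
  using deg_count_image[OF inj_refl_o sg_graph, of sg_o n "sg_a n" "sg_b n" x \<tau> j]
    deg_count_image[OF inj_refl_a sg_graph, of sg_o n "sg_a n" "sg_b n" x \<tau> j]
    sg_outmost[of n] assms
  by (simp_all add: sg_deg_def deg_count_def image_refl_o image_refl_a refl_o_simps refl_a_simps
      corner_forests_swap(1)[of _ _ _ "sg_b n"] corner_forests_swap(2)[of _ _ "sg_b n"])

lemma sg_counts:
  "f_count n = card (sg_forests n Joined)" "g_count n = card (sg_forests n Apart3)"
  "h_count n = card (sg_forests n Separate)"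
  using spanning_trees_eq[OF sg_graph, of sg_o n "sg_a n" "sg_b n"]
    two_tree_subgraphs_eq[OF sg_graph, of sg_o n "sg_a n" "sg_b n"]
    three_tree_subgraphs_eq[OF sg_graph, of sg_o n "sg_a n" "sg_b n"] sg_outmost[of n]
  by (simp_all add: f_count_def g_count_def h_count_def sg_forests_def)

lemma card_sg_forests:
  "card (sg_forests n Joined) = f_count n" "card (sg_forests n Apart3) = g_count n"
  "card (sg_forests n Apart2) = g_count n" "card (sg_forests n Apart1) = g_count n"
  "card (sg_forests n Separate) = h_count n"
  using card_sg_forests_swap(1)[of n Apart3] card_sg_forests_swap(2)[of n Apart3]
  by (simp_all add: sg_counts)

lemma sg_degs:
  "f_deg j n x = sg_deg n Joined j x" "g_deg j n x = sg_deg n Apart3 j x"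
  "h_deg j n x = sg_deg n Separate j x"
  using spanning_trees_eq[OF sg_graph, of sg_o n "sg_a n" "sg_b n"]
    two_tree_subgraphs_eq[OF sg_graph, of sg_o n "sg_a n" "sg_b n"]
    three_tree_subgraphs_eq[OF sg_graph, of sg_o n "sg_a n" "sg_b n"] sg_outmost[of n]
  by (simp_all add: f_deg_def g_deg_def h_deg_def sg_deg_def deg_count_def)

lemma translate_corners:
  "translate (sg_a n) sg_o = sg_a n" "translate (sg_a n) (sg_a n) = sg_a (Suc n)"
  "translate (sg_a n) (sg_b n) = sg_c n" "translate (sg_b n) sg_o = sg_b n"
  "translate (sg_b n) (sg_a n) = sg_c n" "translate (sg_b n) (sg_b n) = sg_b (Suc n)"
  by (simp_all add: translate_def sg_o_def sg_a_def sg_b_def sg_c_def)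

lemma sg_triangle_gluing:
  "triangle_gluing (sg_verts n) (translate (sg_a n) ` sg_verts n) (translate (sg_b n) ` sg_verts n)
    (sg_edges n) ((`) (translate (sg_a n)) ` sg_edges n) ((`) (translate (sg_b n)) ` sg_edges n)
    sg_o (sg_a (Suc n)) (sg_b (Suc n)) (sg_a n) (sg_b n) (sg_c n)"
proof
  show "is_graph (sg_verts n) (sg_edges n)" by (rule sg_graph)
  show "is_graph (translate d ` sg_verts n) ((`) (translate d) ` sg_edges n)" for d
    using inj_translate sg_graph by (rule is_graph_image)
  then show "is_graph (translate (sg_b n) ` sg_verts n) ((`) (translate (sg_b n)) ` sg_edges n)" .
  show "sg_o \<in> sg_verts n" using sg_outmost by blast
  show "sg_a (Suc n) \<in> translate (sg_a n) ` sg_verts n"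
    using sg_outmost translate_corners(2) by (metis imageI)
  show "sg_b (Suc n) \<in> translate (sg_b n) ` sg_verts n"
    using sg_outmost translate_corners(6) by (metis imageI)
  show "sg_verts n \<inter> translate (sg_a n) ` sg_verts n = {sg_a n}"
    "sg_verts n \<inter> translate (sg_b n) ` sg_verts n = {sg_b n}"
    "translate (sg_a n) ` sg_verts n \<inter> translate (sg_b n) ` sg_verts n = {sg_c n}"
    by (rule sg_copies_meet)+
  show "distinct [sg_o, sg_a (Suc n), sg_b (Suc n), sg_a n, sg_b n, sg_c n]"
    by (simp add: sg_o_def sg_a_def sg_b_def sg_c_def)
qed

lemma card_translated_forests:
  "card (corner_forests (translate (sg_a n) ` sg_verts n) ((`) (translate (sg_a n)) ` sg_edges n)
     (sg_a n) (sg_a (Suc n)) (sg_c n) \<tau>) = card (sg_forests n \<tau>)"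
  "card (corner_forests (translate (sg_b n) ` sg_verts n) ((`) (translate (sg_b n)) ` sg_edges n)
     (sg_b n) (sg_c n) (sg_b (Suc n)) \<tau>) = card (sg_forests n \<tau>)"
  using card_corner_forests_image[OF inj_translate sg_graph, of sg_o n "sg_a n" "sg_b n" "sg_a n" \<tau>]
    card_corner_forests_image[OF inj_translate sg_graph, of sg_o n "sg_a n" "sg_b n" "sg_b n" \<tau>]
    sg_outmost[of n]
  by (simp_all only: translate_corners sg_forests_def)

section \<open>Recurrences for the counts\<close>

lemma card_sg_forests_Suc:
  "card (sg_forests (Suc n) \<tau>) = (\<Sum>(\<alpha>, \<beta>, \<gamma>)\<in>{(\<alpha>, \<beta>, \<gamma>). glues \<alpha> \<beta> \<gamma> \<tau>}.
     card (sg_forests n \<alpha>) * card (sg_forests n \<beta>) * card (sg_forests n \<gamma>))"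
  using triangle_gluing.card_corner_forests_total[OF sg_triangle_gluing]
  unfolding card_translated_forests by (simp add: sg_forests_def)

lemma sg_deg_lower_left:
  assumes "x \<in> sg_verts n" "x \<noteq> sg_a n" "x \<noteq> sg_b n"
  shows "sg_deg (Suc n) \<tau> j x = (\<Sum>(\<alpha>, \<beta>, \<gamma>)\<in>{(\<alpha>, \<beta>, \<gamma>). glues \<alpha> \<beta> \<gamma> \<tau>}.
     sg_deg n \<alpha> j x * card (sg_forests n \<beta>) * card (sg_forests n \<gamma>))"
  using triangle_gluing.deg_count_first[OF sg_triangle_gluing assms]
  unfolding card_translated_forests by (simp add: sg_deg_def)

lemma sg_deg_lower_right:
  assumes "x \<in> sg_verts n" "x \<noteq> sg_o" "x \<noteq> sg_b n"
  shows "sg_deg (Suc n) \<tau> j (translate (sg_a n) x) =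
    (\<Sum>(\<alpha>, \<beta>, \<gamma>)\<in>{(\<alpha>, \<beta>, \<gamma>). glues \<alpha> \<beta> \<gamma> \<tau>}.
     card (sg_forests n \<alpha>) * sg_deg n \<beta> j x * card (sg_forests n \<gamma>))"
proof -
  have "translate (sg_a n) x \<noteq> sg_a n" "translate (sg_a n) x \<noteq> sg_c n"
    using assms(2,3) by (simp_all add: translate_def sg_o_def sg_a_def sg_b_def sg_c_def prod_eq_iff)
  moreover have "deg_count (translate (sg_a n) ` sg_verts n) ((`) (translate (sg_a n)) ` sg_edges n)
      (sg_a n) (sg_a (Suc n)) (sg_c n) \<tau> j (translate (sg_a n) x) = sg_deg n \<tau> j x" for \<tau>
    using deg_count_image[OF inj_translate sg_graph, of sg_o n "sg_a n" "sg_b n" x "sg_a n" \<tau> j]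
      sg_outmost[of n] assms(1)
    by (simp only: translate_corners sg_deg_def)
  ultimately show ?thesis
    using triangle_gluing.deg_count_second[OF sg_triangle_gluing, of "translate (sg_a n) x" n \<tau> j] assms(1)
    unfolding card_translated_forests by (simp add: sg_deg_def sg_forests_def)
qed

text \<open>The coefficients are the numbers of triples in the tables: 6 for \<open>Joined\<close>,
  1 and 7 for \<open>Apart3\<close>, 12 and 14 for \<open>Separate\<close>. By symmetry all three
  \<open>Apart\<close> types have \<open>g_count n\<close> forests.\<close>

lemma count_Suc:
  "f_count (Suc n) = 6 * (f_count n)\<^sup>2 * g_count n"
  "g_count (Suc n) = (f_count n)\<^sup>2 * h_count n + 7 * f_count n * (g_count n)\<^sup>2"
  "h_count (Suc n) = 12 * f_count n * g_count n * h_count n + 14 * g_count n ^ 3"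
  unfolding card_sg_forests[symmetric, of "Suc n"] card_sg_forests_Suc
    glues_Joined glues_Apart3 glues_Separate
  by (simp_all add: card_sg_forests power2_eq_square power3_eq_cube algebra_simps)

lemma sg_forests_0:
  "sg_forests 0 Joined = {{{sg_o, sg_a 0}, {sg_o, sg_b 0}}, {{sg_o, sg_a 0}, {sg_a 0, sg_b 0}},
     {{sg_o, sg_b 0}, {sg_a 0, sg_b 0}}}"
  "sg_forests 0 Apart3 = {{{sg_o, sg_a 0}}}"
  "sg_forests 0 Separate = {{}}"
proof -
  have ne: "sg_o \<noteq> sg_a 0" "sg_o \<noteq> sg_b 0" "sg_a 0 \<noteq> sg_b 0"
    "sg_a 0 \<noteq> sg_o" "sg_b 0 \<noteq> sg_o" "sg_b 0 \<noteq> sg_a 0"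
    by (simp_all add: sg_o_def sg_a_def sg_b_def)
  \<comment> \<open>The eight edge sets of a triangle are tested one by one for size and
    type.\<close>
  have subsets: "T \<subseteq> {p, q, r} \<longleftrightarrow> T = {} \<or> T = {r} \<or> T = {q} \<or> T = {q, r} \<or> T = {p} \<or>
      T = {p, r} \<or> T = {p, q} \<or> T = {p, q, r}" for T and p q r :: "vertex set"
    by (simp only: Pow_iff[symmetric] Pow_insert Pow_empty image_Un image_insert image_empty Un_iff
        insert_iff empty_iff simp_thms disj_assoc)
  note simps = sg_forests_def corner_forests_def has_type_def reachable_insert ne doubleton_eq_iff
  have forestsD: "T \<subseteq> {{sg_o, sg_a 0}, {sg_o, sg_b 0}, {sg_a 0, sg_b 0}}"
    "has_type {sg_o, sg_a 0, sg_b 0} T sg_o (sg_a 0) (sg_b 0) \<tau>" "3 = blocks \<tau> + card T"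
    if "T \<in> sg_forests 0 \<tau>" for T \<tau>
    using that by (simp_all add: sg_forests_def corner_forests_def ne)
  show "sg_forests 0 Joined = {{{sg_o, sg_a 0}, {sg_o, sg_b 0}}, {{sg_o, sg_a 0}, {sg_a 0, sg_b 0}},
     {{sg_o, sg_b 0}, {sg_a 0, sg_b 0}}}"
  proof (intro equalityI subsetI)
    fix T
    assume "T \<in> sg_forests 0 Joined"
    from forestsD[OF this, unfolded subsets] show "T \<in> {{{sg_o, sg_a 0}, {sg_o, sg_b 0}},
        {{sg_o, sg_a 0}, {sg_a 0, sg_b 0}}, {{sg_o, sg_b 0}, {sg_a 0, sg_b 0}}}"
      by (elim disjE) (simp_all add: simps)
  qed (elim insertE emptyE; simp add: simps)
  show "sg_forests 0 Apart3 = {{{sg_o, sg_a 0}}}"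
  proof (intro equalityI subsetI)
    fix T
    assume "T \<in> sg_forests 0 Apart3"
    from forestsD[OF this, unfolded subsets] show "T \<in> {{{sg_o, sg_a 0}}}"
      by (elim disjE) (simp_all add: simps)
  qed (elim insertE emptyE; simp add: simps)
  show "sg_forests 0 Separate = {{}}"
  proof (intro equalityI subsetI)
    fix T
    assume "T \<in> sg_forests 0 Separate"
    from forestsD[OF this, unfolded subsets] show "T \<in> {{}}"
      by (elim disjE) (simp_all add: simps)
  qed (elim insertE emptyE; simp add: simps)
qed

text \<open>The counts at stage 0 are 3, 1, 1. Under \<open>f h = 3 g^2\<close> the recurrences
  collapse to \<open>g' = (3 + 7) f g^2\<close> and \<open>h' = (36 + 14) g^3\<close>, and
  \<open>f' h' = 300 f^2 g^4 = 3 g'^2\<close> reproduces the relation.\<close>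

lemma count_relations:
  "f_count n * h_count n = 3 * (g_count n)\<^sup>2 \<and> 0 < f_count n \<and> 0 < g_count n \<and> 0 < h_count n"
proof (induction n)
  case 0
  have "sg_o \<noteq> sg_a 0" "sg_o \<noteq> sg_b 0" "sg_a 0 \<noteq> sg_b 0"
    by (simp_all add: sg_o_def sg_a_def sg_b_def)
  then show ?case
    by (simp add: sg_counts sg_forests_0 doubleton_eq_iff)
next
  case (Suc n)
  let ?f = "f_count n" and ?g = "g_count n" and ?h = "h_count n"
  have g: "g_count (Suc n) = 10 * ?f * ?g\<^sup>2"
    using Suc by (simp add: count_Suc power2_eq_square)
  have h: "h_count (Suc n) = 50 * ?g ^ 3"
    using Suc by (simp add: count_Suc power2_eq_square power3_eq_cube algebra_simps)
  have "f_count (Suc n) * h_count (Suc n) = 3 * (g_count (Suc n))\<^sup>2"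
    unfolding g h count_Suc(1) by (simp add: power2_eq_square power3_eq_cube)
  with Suc g h show ?case by (simp add: count_Suc(1))
qed

section \<open>Transition probabilities\<close>

definition sg_prob :: "nat \<Rightarrow> corner_type \<Rightarrow> nat \<Rightarrow> vertex \<Rightarrow> real" where
  "sg_prob n \<tau> j x = real (sg_deg n \<tau> j x) / real (card (sg_forests n \<tau>))"

lemma B_row_eq:
  assumes "x \<in> sg_verts n"
  shows "B_row j n x = map (\<lambda>\<tau>. sg_prob n \<tau> j x) [Joined, Apart3, Apart2, Apart1, Separate]"
  using sg_deg_swap[OF assms, of Apart2 j] sg_deg_swap[OF assms, of Apart1 j]
  by (simp add: B_row_def F_prob_def G_prob_def H_prob_def sg_degs sg_prob_def card_sg_forests)

lemma F_prob_eq: "F_prob j n x = sg_prob n Joined j x"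
  by (simp add: F_prob_def sg_degs sg_prob_def card_sg_forests)

lemma F_prob_refl_o: "x \<in> sg_verts n \<Longrightarrow> F_prob j n (refl_o x) = F_prob j n x"
  using sg_deg_swap(1)[of x n Joined j] by (simp add: F_prob_eq sg_prob_def)

lemma real_counts_Suc:
  "real (f_count (Suc n)) = 6 * (real (f_count n))\<^sup>2 * real (g_count n)"
  "real (g_count (Suc n)) = 10 * real (f_count n) * (real (g_count n))\<^sup>2"
proof -
  show "real (f_count (Suc n)) = 6 * (real (f_count n))\<^sup>2 * real (g_count n)"
    by (simp add: count_Suc)
  have "g_count (Suc n) = 10 * f_count n * (g_count n)\<^sup>2"
    using count_relations[of n] by (simp add: count_Suc power2_eq_square)
  then show "real (g_count (Suc n)) = 10 * real (f_count n) * (real (g_count n))\<^sup>2"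
    by simp
qed

lemma h_count_eq: "real (h_count n) = 3 * (real (g_count n))\<^sup>2 / real (f_count n)"
proof -
  have "real (f_count n * h_count n) = real (3 * (g_count n)\<^sup>2)" "0 < real (f_count n)"
    using count_relations[of n] by simp_all
  then show ?thesis by (simp add: field_simps)
qed

text \<open>Each coefficient is the share of the triples with the given type in first place. For
  \<open>Joined\<close> these are sixths; for \<open>Apart3\<close> and \<open>Apart2\<close> they
  are tenths in units of \<open>f g^2\<close>, where \<open>f^2 h\<close> counts three units: 3/5 is
  (3 + 3)/10. They form the first three columns of \<open>L_mat\<close>.\<close>

lemma sg_prob_lower_left:
  assumes "x \<in> sg_verts n" "x \<noteq> sg_a n" "x \<noteq> sg_b n"
  shows "sg_prob (Suc n) Joined j x =
      2/3 * sg_prob n Joined j x + 1/6 * sg_prob n Apart3 j x + 1/6 * sg_prob n Apart2 j x"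
    and "sg_prob (Suc n) Apart3 j x =
      3/5 * sg_prob n Joined j x + 3/10 * sg_prob n Apart3 j x + 1/10 * sg_prob n Apart2 j x"
    and "sg_prob (Suc n) Apart2 j x =
      3/5 * sg_prob n Joined j x + 1/10 * sg_prob n Apart3 j x + 3/10 * sg_prob n Apart2 j x"
proof -
  have pos: "0 < real (f_count n)" "0 < real (g_count n)"
    using count_relations[of n] by simp_all
  show "sg_prob (Suc n) Joined j x =
      2/3 * sg_prob n Joined j x + 1/6 * sg_prob n Apart3 j x + 1/6 * sg_prob n Apart2 j x"
    using pos unfolding sg_prob_def sg_deg_lower_left[OF assms] glues_Joined
    by (simp add: card_sg_forests real_counts_Suc field_simps power2_eq_square)
  show "sg_prob (Suc n) Apart3 j x =
      3/5 * sg_prob n Joined j x + 3/10 * sg_prob n Apart3 j x + 1/10 * sg_prob n Apart2 j x"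
    using pos unfolding sg_prob_def sg_deg_lower_left[OF assms] glues_Apart3
    by (simp add: card_sg_forests real_counts_Suc h_count_eq field_simps power2_eq_square)
  show "sg_prob (Suc n) Apart2 j x =
      3/5 * sg_prob n Joined j x + 1/10 * sg_prob n Apart3 j x + 3/10 * sg_prob n Apart2 j x"
    using pos unfolding sg_prob_def sg_deg_lower_left[OF assms] glues_Apart2
    by (simp add: card_sg_forests real_counts_Suc h_count_eq field_simps power2_eq_square)
qed

text \<open>The same shares for the second place, giving the first three columns of
  \<open>R_mat\<close>. \<open>Apart2\<close> involves all five types; its 3/10 is the single triple
  with \<open>Separate\<close> in the middle, of weight \<open>f^2 h\<close>.\<close>

lemma sg_prob_lower_right:
  assumes "x \<in> sg_verts n" "x \<noteq> sg_o" "x \<noteq> sg_b n"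
  shows "sg_prob (Suc n) Joined j (translate (sg_a n) x) =
      2/3 * sg_prob n Joined j x + 1/6 * sg_prob n Apart3 j x + 1/6 * sg_prob n Apart1 j x"
    and "sg_prob (Suc n) Apart3 j (translate (sg_a n) x) =
      3/5 * sg_prob n Joined j x + 3/10 * sg_prob n Apart3 j x + 1/10 * sg_prob n Apart1 j x"
    and "sg_prob (Suc n) Apart2 j (translate (sg_a n) x) =
      1/10 * sg_prob n Joined j x + 1/10 * sg_prob n Apart3 j x + 2/5 * sg_prob n Apart2 j x +
      1/10 * sg_prob n Apart1 j x + 3/10 * sg_prob n Separate j x"
proof -
  have pos: "0 < real (f_count n)" "0 < real (g_count n)"
    using count_relations[of n] by simp_all
  show "sg_prob (Suc n) Joined j (translate (sg_a n) x) =
      2/3 * sg_prob n Joined j x + 1/6 * sg_prob n Apart3 j x + 1/6 * sg_prob n Apart1 j x"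
    using pos unfolding sg_prob_def sg_deg_lower_right[OF assms] glues_Joined
    by (simp add: card_sg_forests real_counts_Suc field_simps power2_eq_square)
  show "sg_prob (Suc n) Apart3 j (translate (sg_a n) x) =
      3/5 * sg_prob n Joined j x + 3/10 * sg_prob n Apart3 j x + 1/10 * sg_prob n Apart1 j x"
    using pos unfolding sg_prob_def sg_deg_lower_right[OF assms] glues_Apart3
    by (simp add: card_sg_forests real_counts_Suc h_count_eq field_simps power2_eq_square)
  show "sg_prob (Suc n) Apart2 j (translate (sg_a n) x) =
      1/10 * sg_prob n Joined j x + 1/10 * sg_prob n Apart3 j x + 2/5 * sg_prob n Apart2 j x +
      1/10 * sg_prob n Apart1 j x + 3/10 * sg_prob n Separate j x"
    using pos unfolding sg_prob_def sg_deg_lower_right[OF assms] glues_Apart2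
    by (simp add: card_sg_forests real_counts_Suc h_count_eq field_simps power2_eq_square)
qed

text \<open>The coordinate sum is at most \<open>2 ^ (n + m)\<close>, whereas the next outer corners
  have sum \<open>2 ^ Suc (n + m)\<close>. So the vertex never becomes an outer corner, and the
  lower-left step can be repeated.\<close>

lemma inner_vertex_mono:
  assumes "x \<in> sg_verts n" "x \<noteq> sg_a n" "x \<noteq> sg_b n"
  shows "x \<in> sg_verts (n + m) \<and> x \<noteq> sg_a (n + m) \<and> x \<noteq> sg_b (n + m)"
proof (induction m)
  case (Suc m)
  then have "fst x + snd x \<le> 2 ^ (n + m)" using sg_verts_bound by blast
  then have "fst x + snd x < 2 ^ Suc (n + m)"
    by (rule le_less_trans) simp
  with Suc show ?case by (auto simp: sg_a_def sg_b_def)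
qed (use assms in simp)

section \<open>Matrices acting on coefficient vectors\<close>

lemma mat_of_rows_list_mult_vec:
  fixes rs :: "real list list"
  assumes "length xs = n" "\<forall>r\<in>set rs. length r = n"
  shows "mat_of_rows_list n rs *\<^sub>v vec_of_list xs =
    vec_of_list (map (\<lambda>r. \<Sum>k<n. r ! k * xs ! k) rs)"
  using assms
  by (intro eq_vecI)
    (auto simp: mat_of_rows_list_def scalar_prod_def vec_of_list_index atLeast0LessThan intro!: sum.cong)

lemma sum_lessThan_5: "(\<Sum>k<5. f k) = f 0 + f 1 + f 2 + f 3 + f (4::nat)" for f :: "nat \<Rightarrow> real"
  by (simp add: eval_nat_numeral)

lemma L_mat_carrier: "L_mat \<in> carrier_mat 5 5"
  by (rule carrier_matI) (simp_all add: L_mat_def mat_of_rows_list_def)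

lemma R_mat_carrier: "R_mat \<in> carrier_mat 5 5"
  by (rule carrier_matI) (simp_all add: R_mat_def mat_of_rows_list_def)

lemma B_mat_carrier: "B_mat j N k \<in> carrier_mat 3 5"
  by (rule carrier_matI) (simp_all add: B_mat_def mat_of_rows_list_def)

lemma L_mat_mult_vec: "L_mat *\<^sub>v vec_of_list [p, q, r, 0, 0] = vec_of_list
    [2/3 * p + 3/5 * q + 3/5 * r, 1/6 * p + 3/10 * q + 1/10 * r, 1/6 * p + 1/10 * q + 3/10 * r, 0, 0]"
  unfolding L_mat_def by (subst mat_of_rows_list_mult_vec) (simp_all add: sum_lessThan_5)

lemma R_mat_mult_vec: "R_mat *\<^sub>v vec_of_list [p, q, r, 0, 0] = vec_of_list
    [2/3 * p + 3/5 * q + 1/10 * r, 1/6 * p + 3/10 * q + 1/10 * r, 2/5 * r,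
     1/6 * p + 1/10 * q + 1/10 * r, 3/10 * r]"
  unfolding R_mat_def by (subst mat_of_rows_list_mult_vec) (simp_all add: sum_lessThan_5)

text \<open>Multiplying coefficients by \<open>L_mat\<close> pulls a combination back by one stage.
  The new coefficients depend on neither the vertex nor the stage. The rightmost factor acts first
  and undoes stage \<open>n + Suc m\<close>, so the induction hypothesis is needed at the altered
  \<open>p\<close>, \<open>q\<close>, \<open>r\<close>.\<close>

lemma L_mat_pow_mult_vec:
  "\<exists>p' q' r'. L_mat ^\<^sub>m m *\<^sub>v vec_of_list [p, q, r, 0, 0] = vec_of_list [p', q', r', 0, 0] \<and>
     (\<forall>n x. x \<in> sg_verts n \<and> x \<noteq> sg_a n \<and> x \<noteq> sg_b n \<longrightarrow>
        p' * sg_prob n Joined j x + q' * sg_prob n Apart3 j x + r' * sg_prob n Apart2 j x =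
        p * sg_prob (n + m) Joined j x + q * sg_prob (n + m) Apart3 j x + r * sg_prob (n + m) Apart2 j x)"
proof (induction m arbitrary: p q r)
  case 0
  have "L_mat ^\<^sub>m 0 *\<^sub>v vec_of_list [p, q, r, 0, 0] = vec_of_list [p, q, r, 0, 0]"
    using L_mat_carrier by (simp add: carrier_vecI)
  then show ?case by auto
next
  case (Suc m)
  let ?p = "2/3 * p + 3/5 * q + 3/5 * r" and ?q = "1/6 * p + 3/10 * q + 1/10 * r"
    and ?r = "1/6 * p + 1/10 * q + 3/10 * r"
  have "L_mat ^\<^sub>m Suc m *\<^sub>v vec_of_list [p, q, r, 0, 0] =
      L_mat ^\<^sub>m m *\<^sub>v (L_mat *\<^sub>v vec_of_list [p, q, r, 0, 0])"
    using L_mat_carrier by (simp add: assoc_mult_mat_vec[of _ 5 5 _ 5] carrier_vecI)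
  also have "\<dots> = L_mat ^\<^sub>m m *\<^sub>v vec_of_list [?p, ?q, ?r, 0, 0]"
    by (simp only: L_mat_mult_vec)
  finally have step: "L_mat ^\<^sub>m Suc m *\<^sub>v vec_of_list [p, q, r, 0, 0] =
      L_mat ^\<^sub>m m *\<^sub>v vec_of_list [?p, ?q, ?r, 0, 0]" .
  have shift: "?p * sg_prob (n + m) Joined j x + ?q * sg_prob (n + m) Apart3 j x +
      ?r * sg_prob (n + m) Apart2 j x = p * sg_prob (n + Suc m) Joined j x +
      q * sg_prob (n + Suc m) Apart3 j x + r * sg_prob (n + Suc m) Apart2 j x"
    if "x \<in> sg_verts n \<and> x \<noteq> sg_a n \<and> x \<noteq> sg_b n" for n x
    using sg_prob_lower_left[of x "n + m" j] inner_vertex_mono[of x n m] that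
    by (simp add: algebra_simps)
  obtain p' q' r' where IH: "L_mat ^\<^sub>m m *\<^sub>v vec_of_list [?p, ?q, ?r, 0, 0] = vec_of_list [p', q', r', 0, 0]"
    "\<And>n x. x \<in> sg_verts n \<and> x \<noteq> sg_a n \<and> x \<noteq> sg_b n \<Longrightarrow>
        p' * sg_prob n Joined j x + q' * sg_prob n Apart3 j x + r' * sg_prob n Apart2 j x =
        ?p * sg_prob (n + m) Joined j x + ?q * sg_prob (n + m) Apart3 j x + ?r * sg_prob (n + m) Apart2 j x"
    using Suc.IH[of ?p ?q ?r] by blast
  show ?case
    unfolding step IH(1)
    by (rule exI[of _ p'], rule exI[of _ q'], rule exI[of _ r']) (use IH(2) shift in metis)
qed

lemma unit_vec_5_0: "unit_vec 5 0 = vec_of_list [1, 0, 0, 0, 0::real]"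
  by (rule eq_vecI) (auto simp: unit_vec_def vec_of_list_index less_Suc_eq eval_nat_numeral)

theorem propositionV1:
  fixes n m j :: nat
  assumes "2 \<le> n" and "j \<in> {1, 2, 3, 4}"
  shows "vec_of_list [F_prob j (n + m) (sg_a1 (n - 1)),
                      F_prob j (n + m) (sg_b1 (n - 1)),
                      F_prob j (n + m) (sg_c1 (n - 1))]
           = vec_of_list [F_prob j (n + m) (refl_o (sg_a1 (n - 1))),
                          F_prob j (n + m) (refl_o (sg_b1 (n - 1))),
                          F_prob j (n + m) (refl_o (sg_c1 (n - 1)))]
       \<and> vec_of_list [F_prob j (n + m) (refl_o (sg_a1 (n - 1))),
                      F_prob j (n + m) (refl_o (sg_b1 (n - 1))),
                      F_prob j (n + m) (refl_o (sg_c1 (n - 1)))]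
           = (B_mat j (n - 1) (n - 2) * R_mat * L_mat ^\<^sub>m m) *\<^sub>v unit_vec 5 0"
proof -
  obtain i where n: "n = Suc (Suc i)"
    using assms(1) by (metis add_2_eq_Suc le_Suc_ex)
  \<comment> \<open>The lower-right copy has stage \<open>?N\<close>, and the three midpoints are
    the translates of \<open>sg_a i\<close>, \<open>sg_b i\<close>, \<open>sg_c i\<close>, where the
    copies of stage \<open>i\<close> in it meet.\<close>
  let ?N = "Suc i"
  \<comment> \<open>The start \<open>(1, 0, 0)\<close> selects \<open>F_prob\<close> alone at stage
    \<open>n + m\<close>.\<close>
  obtain p q r where L: "L_mat ^\<^sub>m m *\<^sub>v vec_of_list [1, 0, 0, 0, 0] = vec_of_list [p, q, r, 0, 0]"
    and prob: "\<And>n x. x \<in> sg_verts n \<Longrightarrow> x \<noteq> sg_a n \<Longrightarrow> x \<noteq> sg_b n \<Longrightarrow>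
      p * sg_prob n Joined j x + q * sg_prob n Apart3 j x + r * sg_prob n Apart2 j x =
      sg_prob (n + m) Joined j x"
    using L_mat_pow_mult_vec[of m 1 0 0 j] by auto
  \<comment> \<open>The image of \<open>(p, q, r, 0, 0)\<close> under \<open>R_mat\<close>.\<close>
  let ?v = "[2/3 * p + 3/5 * q + 1/10 * r, 1/6 * p + 3/10 * q + 1/10 * r, 2/5 * r,
     1/6 * p + 1/10 * q + 1/10 * r, 3/10 * r]"
  \<comment> \<open>The first coordinate is at least \<open>2 ^ ?N\<close>, which excludes
    \<open>sg_b n\<close>; the translate is \<open>sg_a n\<close> only for
    \<open>y = sg_a ?N\<close>.\<close>
  have inner: "translate (sg_a ?N) y \<in> sg_verts n \<and> translate (sg_a ?N) y \<noteq> sg_a n \<and>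
      translate (sg_a ?N) y \<noteq> sg_b n" if "y \<in> sg_verts ?N" "y \<noteq> sg_a ?N" for y
    using that n by (auto simp: translate_def sg_a_def sg_b_def prod_eq_iff)
  \<comment> \<open>The \<open>m\<close> lower-left steps lead from stage \<open>n + m\<close> to
    stage \<open>n\<close>, and one lower-right step leads on to stage \<open>?N\<close>.\<close>
  have row: "F_prob j (n + m) (translate (sg_a ?N) y) = (\<Sum>k<5. B_row j ?N y ! k * ?v ! k)"
    if y: "y \<in> sg_verts ?N" "y \<noteq> sg_o" "y \<noteq> sg_a ?N" "y \<noteq> sg_b ?N" for y
  proof -
    have "F_prob j (n + m) (translate (sg_a ?N) y) =
        p * sg_prob n Joined j (translate (sg_a ?N) y) + q * sg_prob n Apart3 j (translate (sg_a ?N) y) +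
        r * sg_prob n Apart2 j (translate (sg_a ?N) y)"
      using prob[of "translate (sg_a ?N) y" n] inner[of y] y by (simp add: F_prob_eq)
    then show ?thesis
      unfolding n sg_prob_lower_right[OF y(1,2,4)] B_row_eq[OF y(1)] sum_lessThan_5
      by (simp add: algebra_simps)
  qed
  have mid: "y \<in> sg_verts ?N" "y \<noteq> sg_o" "y \<noteq> sg_a ?N" "y \<noteq> sg_b ?N"
    if "y \<in> {sg_a i, sg_b i, sg_c i}" for y
  proof -
    have "sg_c i \<in> translate (sg_a i) ` sg_verts i"
      using sg_outmost translate_corners(3) by (metis imageI)
    then show "y \<in> sg_verts ?N" using that sg_outmost[of i] by auto
    show "y \<noteq> sg_o" "y \<noteq> sg_a ?N" "y \<noteq> sg_b ?N"
      using that by (auto simp: sg_o_def sg_a_def sg_b_def sg_c_def)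
  qed
  have points: "sg_a1 (n - 1) = translate (sg_a ?N) (sg_a i)" "sg_b1 (n - 1) = translate (sg_a ?N) (sg_b i)"
    "sg_c1 (n - 1) = translate (sg_a ?N) (sg_c i)"
    using sg_mid_translate[of ?N i] n by simp_all
  have refl: "F_prob j (n + m) (refl_o (translate (sg_a ?N) y)) = F_prob j (n + m) (translate (sg_a ?N) y)"
    if "y \<in> {sg_a i, sg_b i, sg_c i}" for y
    using inner_vertex_mono[of "translate (sg_a ?N) y" n m] inner[OF mid(1,3)[OF that]]
    by (intro F_prob_refl_o) blast
  have "(B_mat j (n - 1) (n - 2) * R_mat * L_mat ^\<^sub>m m) *\<^sub>v unit_vec 5 0 =
      B_mat j ?N i *\<^sub>v (R_mat *\<^sub>v (L_mat ^\<^sub>m m *\<^sub>v unit_vec 5 0))"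
  proof -
    have "L_mat ^\<^sub>m m \<in> carrier_mat 5 5" using L_mat_carrier by simp
    then show ?thesis
      using B_mat_carrier[of j ?N i] R_mat_carrier n
      by (simp add: assoc_mult_mat_vec[of _ 3 5 _ 5] mult_carrier_mat[of _ 3 5])
  qed
  also have "\<dots> = B_mat j ?N i *\<^sub>v vec_of_list ?v"
    unfolding unit_vec_5_0 L R_mat_mult_vec ..
  also have "\<dots> = vec_of_list (map (\<lambda>b. \<Sum>k<5. b ! k * ?v ! k)
      [B_row j ?N (sg_a i), B_row j ?N (sg_b i), B_row j ?N (sg_c i)])"
    unfolding B_mat_def by (rule mat_of_rows_list_mult_vec) (simp_all add: B_row_def)
  also have "\<dots> = vec_of_list [F_prob j (n + m) (sg_a1 (n - 1)), F_prob j (n + m) (sg_b1 (n - 1)),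
      F_prob j (n + m) (sg_c1 (n - 1))]"
    unfolding points list.map using row[OF mid] by (simp only: insertI1 insertI2 simp_thms)
  finally show ?thesis
    unfolding points using refl by simp
qed

end
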